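(* Let $\mathfrak{g}$ be a simple simply laced complex Lie algebra. If $\mathbf{i}\in R(w_0)$ is simply-braided, then $\varsigma_{\mathbf{i},i}$ is multiplicity-free for all $i\in I$. In particular, the set of inequalities given by $[\varsigma_{\mathbf{i},i}]_{trop}(t)\ge0$, $i\in I$ (one inequality for each Laurent monomial of each $\varsigma_{\mathbf{i},i}$, $i\in I$), is non-redundant.
   Context: Setting. $\mathfrak{g}$ has rank $n$, $I=\{1,\dots,n\}$, Cartan matrix $(c_{i,j})$, simple roots $\alpha_i$, fundamental weights $\omega_i$, set of positive roots $\Delta^+$, Weyl group $W$ with simple reflections $s_i$, longest element $w_0$ of length $N$. For $i\in I$, $i^*\in I$ is determined by $w_0\omega_i=-\omega_{i^*}$. $R(w_0)$ is the set of reduced words $\mathbf{i}=(i_1,\dots,i_N)$ of $w_0$, i.e. $w_0=s_{i_1}\cdots s_{i_N}$. A word $\mathbf{i}$ orders $\Delta^+$ as $\beta_1,\dots,\beta_N$ with $\beta_k=s_{i_1}\cdots s_{i_{k-1}}(\alpha_{i_k})$. A word $\mathbf{j}$ is obtained from $\mathbf{i}$ by a $2$-term move at position $k$ if $(j_k,j_{k+1})=(i_{k+1},i_k)$, $c_{i_k,i_{k+1}}=0$, and all other letters agree; by a $3$-term move at position $k$ if $j_{k-1}=j_{k+1}=i_k$, $j_k=i_{k-1}=i_{k+1}$, $c_{i_k,i_{k+1}}=-1$, and all other letters agree. Any two elements of $R(w_0)$ are connected by such moves. Simply-braided. For $i\in I$, $\mathbf{i}\in R(w_0)$ is simply-braided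 for $i$ if there is a sequence of moves changing $\mathbf{i}$ to a reduced word $\mathbf{i}'=(i'_1,\dots,i'_N)\in R(w_0)$ with $i'_N=i$ such that each move in the sequence is either a $2$-term move or a $3$-term move at a position $k$ such that $\beta_{k-1}=\alpha_{i^*}$ in the ordering of $\Delta^+$ given by the word to which the move is applied (i.e. $\alpha_{i^*}$ is the leftmost root affected). $\mathbf{i}$ is simply-braided if it is simply-braided for all $i\in I$. String transition maps. If $\mathbf{j}$ arises from $\mathbf{i}$ by a $3$-term move at position $k$, the piecewise linear map $\Psi^{\mathbf{i}}_{\mathbf{j}}$, $x\mapsto x'$, is $x'_{k-1}=\max(x_{k+1},x_k-x_{k-1})$, $x'_k=x_{k-1}+x_{k+1}$, $x'_{k+1}=\min(x_{k-1},x_k-x_{k+1})$, other coordinates unchanged; for a $2$-term move at position $k$ it swaps $x_k$ and $x_{k+1}$. The subtraction-free birational lift $\widehat\Psi^{\mathbf{i}}_{\mathbf{j}}:(\mathbb{C}^* )^N\dashrightarrow(\mathbb{C}^* )^N$ is, for a $3$-term move, $x'_{k-1}=\frac{x_kx_{k+1}}{x_k+x_{k-1}x_{k+1}}$, $x'_k=x_{k-1}x_{k+1}$, $x'_{k+1}=x_{k-1}+\frac{x_k}{x_{k+1}}$, other coordinates unchanged, and for a $2$-term move the same swap; its tropicalization is $\Psi^{\mathbf{i}}_{\mathbf{j}}$. For arbitrary $\mathbf{i},\mathbf{j}$ one composes along a sequence of moves. The functions $\varsigma_{\mathbf{i},i}$ ($\mathbf{i}\in R(w_0)$, $i\in I$)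 are the rational functions in $x_1,\dots,x_N$ determined by: (1) if $i_N=i$ then $\varsigma_{\mathbf{i},i}(x)=x_N$; (2) $\varsigma_{\mathbf{i},i}\circ\widehat\Psi^{\mathbf{j}}_{\mathbf{i}}=\varsigma_{\mathbf{j},i}$ for all $\mathbf{i},\mathbf{j}\in R(w_0)$. They are Laurent polynomials with non-negative integer coefficients. $\varsigma_{\mathbf{i},i}$ is multiplicity-free if in every Laurent monomial occurring in it with non-zero coefficient all exponents have absolute value $\le1$. Tropicalization: for a Laurent polynomial $f=\sum_u a_ux^u$ with $a_u\geq 0$, $[f]_{trop}(t)=\min_{u:\,a_u\ne0}\langle t,u\rangle$ with the standard inner product; thus $[f]_{trop}(t)\ge 0$ amounts to the inequalities $\langle t,u\rangle\ge0$, one per monomial of $f$. A set of such inequalities indexed by monomials is redundant if the linear form of some monomial is a linear combination with non-negative real coefficients of the linear forms of the other monomials; otherwise it is non-redundant. *)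

theory Defs
  imports
    "HOL-Analysis.Analysis"
    "HOL-Library.Poly_Mapping"
    "HOL-Computational_Algebra.Fraction_Field"
begin

section \<open>Root data\<close>

text \<open>
  The simple Lie algebra enters only through its root system, realised in the Euclidean space
  spanned by the roots and carrying an inner product invariant under the Weyl group.  Simple
  complex Lie algebras correspond to irreducible reduced root systems; the algebra is simply
  laced when all off-diagonal Cartan integers are 0 or -1.
\<close>

definition reflection :: "'a::real_inner \<Rightarrow> 'a \<Rightarrow> 'a" where
  "reflection a v = v - (2 * (a \<bullet> v) / (a \<bullet> a)) *\<^sub>R a"

definition root_system :: "'a::euclidean_space set \<Rightarrow> bool" where
  "root_system \<Phi> \<longleftrightarrow>
     finite \<Phi> \<and> span \<Phi> = UNIV \<and> 0 \<notin> \<Phi> \<and>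
     (\<forall>a\<in>\<Phi>. reflection a ` \<Phi> = \<Phi>) \<and>
     (\<forall>a\<in>\<Phi>. \<forall>b\<in>\<Phi>. 2 * (a \<bullet> b) / (a \<bullet> a) \<in> \<int>) \<and>
     (\<forall>a\<in>\<Phi>. \<forall>r. r *\<^sub>R a \<in> \<Phi> \<longrightarrow> r = 1 \<or> r = -1)"

definition irreducible_root_system :: "'a::euclidean_space set \<Rightarrow> bool" where
  "irreducible_root_system \<Phi> \<longleftrightarrow>
     root_system \<Phi> \<and> \<Phi> \<noteq> {} \<and>
     \<not> (\<exists>A B. A \<noteq> {} \<and> B \<noteq> {} \<and> A \<union> B = \<Phi> \<and> (\<forall>a\<in>A. \<forall>b\<in>B. a \<bullet> b = 0))"

definition simple_roots :: "'a::euclidean_space set \<Rightarrow> nat \<Rightarrow> (nat \<Rightarrow> 'a) \<Rightarrow> bool" where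
  "simple_roots \<Phi> n \<alpha> \<longleftrightarrow>
     inj_on \<alpha> {1..n} \<and> \<alpha> ` {1..n} \<subseteq> \<Phi> \<and> independent (\<alpha> ` {1..n}) \<and>
     (\<forall>b\<in>\<Phi>. \<exists>m::nat \<Rightarrow> nat.
        b = (\<Sum>i\<in>{1..n}. real (m i) *\<^sub>R \<alpha> i) \<or> b = - (\<Sum>i\<in>{1..n}. real (m i) *\<^sub>R \<alpha> i))"

definition cartan :: "(nat \<Rightarrow> 'a::real_inner) \<Rightarrow> nat \<Rightarrow> nat \<Rightarrow> real" where
  "cartan \<alpha> i j = 2 * (\<alpha> i \<bullet> \<alpha> j) / (\<alpha> i \<bullet> \<alpha> i)"

definition simply_laced :: "nat \<Rightarrow> (nat \<Rightarrow> 'a::real_inner) \<Rightarrow> bool" where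
  "simply_laced n \<alpha> \<longleftrightarrow> (\<forall>i\<in>{1..n}. \<forall>j\<in>{1..n}. i \<noteq> j \<longrightarrow> cartan \<alpha> i j \<in> {0, -1})"

definition fund_weight :: "nat \<Rightarrow> (nat \<Rightarrow> 'a::real_inner) \<Rightarrow> nat \<Rightarrow> 'a" where
  "fund_weight n \<alpha> i =
     (THE v. \<forall>j\<in>{1..n}. 2 * (\<alpha> j \<bullet> v) / (\<alpha> j \<bullet> \<alpha> j) = (if j = i then 1 else 0))"

section \<open>Weyl group and reduced words\<close>

definition words :: "nat \<Rightarrow> nat list set" where
  "words n = {w. set w \<subseteq> {1..n}}"

text \<open>The word \<open>[i1, \<dots>, ik]\<close> acts as the product of simple reflections in this order, so that
  the reflection belonging to \<open>ik\<close> is applied first.\<close>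

definition word_act :: "(nat \<Rightarrow> 'a::real_inner) \<Rightarrow> nat list \<Rightarrow> 'a \<Rightarrow> 'a" where
  "word_act \<alpha> w = foldr (\<lambda>i f. reflection (\<alpha> i) \<circ> f) w id"

definition weyl_group :: "nat \<Rightarrow> (nat \<Rightarrow> 'a::real_inner) \<Rightarrow> ('a \<Rightarrow> 'a) set" where
  "weyl_group n \<alpha> = word_act \<alpha> ` words n"

definition weyl_length :: "nat \<Rightarrow> (nat \<Rightarrow> 'a::real_inner) \<Rightarrow> ('a \<Rightarrow> 'a) \<Rightarrow> nat" where
  "weyl_length n \<alpha> g = (LEAST k. \<exists>w\<in>words n. length w = k \<and> word_act \<alpha> w = g)"

definition longest_element :: "nat \<Rightarrow> (nat \<Rightarrow> 'a::real_inner) \<Rightarrow> 'a \<Rightarrow> 'a" where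
  "longest_element n \<alpha> = (ARG_MAX (weyl_length n \<alpha>) g. g \<in> weyl_group n \<alpha>)"

definition longest_length :: "nat \<Rightarrow> (nat \<Rightarrow> 'a::real_inner) \<Rightarrow> nat" where
  "longest_length n \<alpha> = weyl_length n \<alpha> (longest_element n \<alpha>)"

definition reduced_words :: "nat \<Rightarrow> (nat \<Rightarrow> 'a::real_inner) \<Rightarrow> nat list set" where
  "reduced_words n \<alpha> =
     {w \<in> words n. length w = longest_length n \<alpha> \<and> word_act \<alpha> w = longest_element n \<alpha>}"

definition star :: "nat \<Rightarrow> (nat \<Rightarrow> 'a::real_inner) \<Rightarrow> nat \<Rightarrow> nat" where
  "star n \<alpha> i =
     (THE j. j \<in> {1..n} \<and> longest_element n \<alpha> (fund_weight n \<alpha> i) = - fund_weight n \<alpha> j)"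

section \<open>Moves and simply-braided words\<close>

text \<open>Letters, roots and coordinates along a word are numbered from 0, and a move is located by
  the leftmost position \<open>l\<close> that it affects.  Hence a 3-term move at \<open>l\<close> has its middle letter at
  place \<open>l + 2\<close> when counting from 1.\<close>

definition word_root :: "(nat \<Rightarrow> 'a::real_inner) \<Rightarrow> nat list \<Rightarrow> nat \<Rightarrow> 'a" where
  "word_root \<alpha> w k = word_act \<alpha> (take k w) (\<alpha> (w ! k))"

definition two_term_move ::
    "(nat \<Rightarrow> 'a::real_inner) \<Rightarrow> nat \<Rightarrow> nat list \<Rightarrow> nat list \<Rightarrow> bool" where
  "two_term_move \<alpha> l w w' \<longleftrightarrow>
     (\<exists>u a b v. length u = l \<and> w = u @ [a, b] @ v \<and> w' = u @ [b, a] @ v \<and> cartan \<alpha> a b = 0)"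

definition three_term_move ::
    "(nat \<Rightarrow> 'a::real_inner) \<Rightarrow> nat \<Rightarrow> nat list \<Rightarrow> nat list \<Rightarrow> bool" where
  "three_term_move \<alpha> l w w' \<longleftrightarrow>
     (\<exists>u a b v. length u = l \<and> w = u @ [a, b, a] @ v \<and> w' = u @ [b, a, b] @ v \<and>
        cartan \<alpha> b a = -1)"

definition simple_move ::
    "nat \<Rightarrow> (nat \<Rightarrow> 'a::real_inner) \<Rightarrow> nat \<Rightarrow> nat list \<Rightarrow> nat list \<Rightarrow> bool" where
  "simple_move n \<alpha> i w w' \<longleftrightarrow>
     (\<exists>l. two_term_move \<alpha> l w w') \<or>
     (\<exists>l. three_term_move \<alpha> l w w' \<and> word_root \<alpha> w l = \<alpha> (star n \<alpha> i))"

definition simply_braided_for ::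
    "nat \<Rightarrow> (nat \<Rightarrow> 'a::real_inner) \<Rightarrow> nat \<Rightarrow> nat list \<Rightarrow> bool" where
  "simply_braided_for n \<alpha> i w \<longleftrightarrow>
     (\<exists>w'\<in>reduced_words n \<alpha>. (simple_move n \<alpha> i)\<^sup>*\<^sup>* w w' \<and> last w' = i)"

definition simply_braided :: "nat \<Rightarrow> (nat \<Rightarrow> 'a::real_inner) \<Rightarrow> nat list \<Rightarrow> bool" where
  "simply_braided n \<alpha> w \<longleftrightarrow> (\<forall>i\<in>{1..n}. simply_braided_for n \<alpha> i w)"

section \<open>Laurent polynomials and rational functions\<close>

text \<open>A Laurent monomial is a finitely supported exponent vector; the product of
  Laurent polynomials is convolution.  The fraction field of the Laurent polynomial ring is the field
  of rational functions, in which \<open>Fract p 1\<close> is the Laurent polynomial \<open>p\<close>.\<close>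

type_synonym exponents = "nat \<Rightarrow>\<^sub>0 int"
type_synonym laurent = "exponents \<Rightarrow>\<^sub>0 complex"
type_synonym ratfun = "laurent fract"

definition var :: "nat \<Rightarrow> ratfun" where
  "var k = Fract (Poly_Mapping.single (Poly_Mapping.single k 1) 1) 1"

text \<open>The rational functions in \<open>x\<^sub>0, \<dots>, x\<^sub>N\<^sub>-\<^sub>1\<close>.\<close>

definition ratfuns :: "nat \<Rightarrow> ratfun set" where
  "ratfuns N = {Fract p q | p q. q \<noteq> 0 \<and>
     (\<forall>u \<in> Poly_Mapping.keys p \<union> Poly_Mapping.keys q. Poly_Mapping.keys u \<subseteq> {..<N})}"

definition laurent_subst :: "(nat \<Rightarrow> ratfun) \<Rightarrow> laurent \<Rightarrow> ratfun" where
  "laurent_subst y p =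
     (\<Sum>u\<in>Poly_Mapping.keys p.
        Fract (Poly_Mapping.single 0 (Poly_Mapping.lookup p u)) 1 *
        (\<Prod>k\<in>Poly_Mapping.keys u. y k powi Poly_Mapping.lookup u k))"

text \<open>\<open>subst y f\<close> is the composition \<open>f \<circ> y\<close>.  For nonzero \<open>y k\<close> the map
  \<^term>\<open>laurent_subst y\<close> is a ring homomorphism, so the value does not depend on the fraction
  chosen to represent \<open>f\<close>; the composition is meaningful when some representing fraction has a
  denominator that does not become 0.\<close>

definition subst :: "(nat \<Rightarrow> ratfun) \<Rightarrow> ratfun \<Rightarrow> ratfun" where
  "subst y f =
     (THE g. \<exists>p q. q \<noteq> 0 \<and> f = Fract p q \<and> laurent_subst y q \<noteq> 0 \<and>
        g = laurent_subst y p / laurent_subst y q)"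

section \<open>Birational transition maps\<close>

text \<open>A rational map is given by the tuple of its coordinate functions.\<close>

definition two_term_map :: "nat \<Rightarrow> nat \<Rightarrow> ratfun" where
  "two_term_map l = var(l := var (l + 1), l + 1 := var l)"

definition three_term_map :: "nat \<Rightarrow> nat \<Rightarrow> ratfun" where
  "three_term_map l = var(
     l := var (l + 1) * var (l + 2) / (var (l + 1) + var l * var (l + 2)),
     l + 1 := var l * var (l + 2),
     l + 2 := var l + var (l + 1) / var (l + 2))"

text \<open>\<open>transition \<alpha> w w' y\<close>: composing the maps along some sequence of moves from \<open>w\<close> to \<open>w'\<close>
  gives the rational map \<open>y\<close>, from the coordinates for \<open>w\<close> to those for \<open>w'\<close>.\<close>

inductive transition ::
    "(nat \<Rightarrow> 'a::real_inner) \<Rightarrow> nat list \<Rightarrow> nat list \<Rightarrow> (nat \<Rightarrow> ratfun) \<Rightarrow> bool"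
  for \<alpha> w where
  refl: "transition \<alpha> w w var"
| two: "transition \<alpha> w w' y \<Longrightarrow> two_term_move \<alpha> l w' w'' \<Longrightarrow>
    transition \<alpha> w w'' (\<lambda>k. subst y (two_term_map l k))"
| three: "transition \<alpha> w w' y \<Longrightarrow> three_term_move \<alpha> l w' w'' \<Longrightarrow>
    transition \<alpha> w w'' (\<lambda>k. subst y (three_term_map l k))"

text \<open>The conditions that determine the functions \<open>\<sigma> w i\<close> for all reduced words \<open>w\<close> of the
  longest element and all \<open>i \<in> {1..n}\<close>.\<close>

definition sigma_family ::
    "nat \<Rightarrow> (nat \<Rightarrow> 'a::real_inner) \<Rightarrow> (nat list \<Rightarrow> nat \<Rightarrow> ratfun) \<Rightarrow> bool" where
  "sigma_family n \<alpha> \<sigma> \<longleftrightarrow>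
     (\<forall>w\<in>reduced_words n \<alpha>. \<forall>i\<in>{1..n}. \<sigma> w i \<in> ratfuns (length w)) \<and>
     (\<forall>w\<in>reduced_words n \<alpha>. \<forall>i\<in>{1..n}. last w = i \<longrightarrow> \<sigma> w i = var (length w - 1)) \<and>
     (\<forall>w\<in>reduced_words n \<alpha>. \<forall>v\<in>reduced_words n \<alpha>. \<forall>i\<in>{1..n}. \<forall>y.
        transition \<alpha> v w y \<longrightarrow> subst y (\<sigma> w i) = \<sigma> v i)"

section \<open>Multiplicity-freeness and redundancy\<close>

definition is_laurent :: "ratfun \<Rightarrow> bool" where
  "is_laurent f \<longleftrightarrow> (\<exists>p. f = Fract p 1)"

text \<open>The exponent vectors of the Laurent monomials of a Laurent polynomial
  (\<open>p\<close> is determined by \<open>f\<close>).\<close>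

definition monomials :: "ratfun \<Rightarrow> exponents set" where
  "monomials f = {u. \<exists>p. f = Fract p 1 \<and> u \<in> Poly_Mapping.keys p}"

definition multiplicity_free :: "ratfun \<Rightarrow> bool" where
  "multiplicity_free f \<longleftrightarrow>
     is_laurent f \<and> (\<forall>u\<in>monomials f. \<forall>k. \<bar>Poly_Mapping.lookup u k\<bar> \<le> 1)"

definition linear_form :: "exponents \<Rightarrow> (nat \<Rightarrow> real) \<Rightarrow> real" where
  "linear_form u t = (\<Sum>k\<in>Poly_Mapping.keys u. t k * of_int (Poly_Mapping.lookup u k))"

text \<open>\<open>M\<close> is a finite index set, and \<open>m \<in> M\<close> stands for the inequality \<open>L m t \<ge> 0\<close>.\<close>

definition redundant :: "'b set \<Rightarrow> ('b \<Rightarrow> (nat \<Rightarrow> real) \<Rightarrow> real) \<Rightarrow> bool" where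
  "redundant M L \<longleftrightarrow>
     (\<exists>m\<in>M. \<exists>c. (\<forall>m'\<in>M - {m}. 0 \<le> c m') \<and>
        (\<forall>t. L m t = (\<Sum>m'\<in>M - {m}. c m' * L m' t)))"

end

theory Submission
  imports Defs "HOL-Combinatorics.Transposition"
begin

text \<open>
  The function \<open>\<sigma> w i\<close> of a word that is simply-braided for \<open>i\<close> has the form
  \<open>x\<^sub>p + \<Sum>\<^bsub>(a, b)\<^esub> x\<^sub>a / x\<^sub>b\<close>, where \<open>p\<close> is the position of the root
  \<open>\<beta>\<^sub>p = \<alpha>\<close> with \<open>\<alpha> = \<alpha>\<^sub>i\<^sub>*\<close>, and where \<open>a, b > p\<close> and
  \<open>\<beta>\<^sub>a = \<alpha> + \<beta>\<^sub>b\<close>.  This is shown by going backwards from a word ending in \<open>i\<close>, whose last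
  root is \<open>\<alpha>\<close>.  A 2-term move permutes the variables; it cannot move \<open>a\<close> or \<open>b\<close> to the left of
  \<open>p\<close>, because \<open>\<beta>\<^sub>a\<close> and \<open>\<beta>\<^sub>b\<close> are not orthogonal to \<open>\<alpha>\<close>.  Undoing a 3-term
  move with \<open>\<beta>\<^sub>l = \<alpha>\<close> replaces \<open>x\<^sub>p\<close>, where \<open>p = l + 2\<close>, by \<open>x\<^sub>l + x\<^sub>l\<^sub>+\<^sub>1 / x\<^sub>l\<^sub>+\<^sub>2\<close> and does not
  touch the other terms, whose variables lie to the right of \<open>p\<close>.

  Since the roots along a reduced word are distinct, the inequalities for all \<open>i\<close> are
  \<open>t (A + \<alpha>\<^sub>i\<^sub>*) \<ge> t A\<close> for pairwise distinct pairs \<open>(A, i)\<close>, with \<open>A\<close> a positive root or 0 and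
  \<open>t 0 = 0\<close>.  Each of them is violated by some \<open>t\<close> that satisfies all the others.
\<close>

section \<open>Substitution into Laurent polynomials\<close>

definition mon_subst :: "(nat \<Rightarrow> ratfun) \<Rightarrow> exponents \<Rightarrow> ratfun" where
  "mon_subst y u = (\<Prod>k\<in>Poly_Mapping.keys u. y k powi Poly_Mapping.lookup u k)"

abbreviation coeff_fract :: "complex \<Rightarrow> ratfun" where
  "coeff_fract c \<equiv> Fract (Poly_Mapping.single 0 c) 1"

definition monomial :: "exponents \<Rightarrow> ratfun" where
  "monomial u = Fract (Poly_Mapping.single u 1) 1"

lemma Fract_add_1: "Fract (p + q) 1 = Fract p 1 + Fract (q :: laurent) 1"
  by simp

lemma Fract_sum_1: "Fract (\<Sum>i\<in>A. f i) 1 = (\<Sum>i\<in>A. Fract (f i :: laurent) 1)"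
  by (induction A rule: infinite_finite_induct)
    (simp_all add: fract_collapse Fract_add_1 del: add_fract)

lemma coeff_fract_add: "coeff_fract (a + b) = coeff_fract a + coeff_fract b"
  by (simp add: single_add)

lemma coeff_fract_mult: "coeff_fract (a * b) = coeff_fract a * coeff_fract b"
  by (simp add: mult_single)

text \<open>A variable outside \<open>keys u\<close> has exponent 0 and contributes the factor 1.
  This allows two monomials to be compared over one common index set.\<close>

lemma mon_subst_superset:
  assumes "finite A" "Poly_Mapping.keys u \<subseteq> A"
  shows "mon_subst y u = (\<Prod>k\<in>A. y k powi Poly_Mapping.lookup u k)"
  unfolding mon_subst_def using assms by (intro prod.mono_neutral_left) (auto simp: in_keys_iff)

text \<open>Exponents may have opposite signs, so adding them under \<open>powi\<close> requires
  nonzero values of the \<open>y k\<close>.\<close>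

lemma mon_subst_add:
  assumes "\<And>k. y k \<noteq> 0"
  shows "mon_subst y (u + v) = mon_subst y u * mon_subst y v"
proof -
  let ?A = "Poly_Mapping.keys u \<union> Poly_Mapping.keys v"
  have "Poly_Mapping.keys (u + v) \<subseteq> ?A"
    by (rule keys_add)
  then show ?thesis
    by (simp add: mon_subst_superset[of ?A] lookup_add power_int_add assms prod.distrib)
qed

lemma laurent_subst_eq:
  "laurent_subst y p = (\<Sum>u\<in>Poly_Mapping.keys p. coeff_fract (Poly_Mapping.lookup p u) * mon_subst y u)"
  by (simp add: laurent_subst_def mon_subst_def)

lemma laurent_subst_superset:
  assumes "finite A" "Poly_Mapping.keys p \<subseteq> A"
  shows "laurent_subst y p = (\<Sum>u\<in>A. coeff_fract (Poly_Mapping.lookup p u) * mon_subst y u)"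
  unfolding laurent_subst_eq using assms
  by (intro sum.mono_neutral_left) (auto simp: in_keys_iff fract_collapse)

lemma laurent_subst_add: "laurent_subst y (p + q) = laurent_subst y p + laurent_subst y q"
proof -
  let ?A = "Poly_Mapping.keys p \<union> Poly_Mapping.keys q"
  have "Poly_Mapping.keys (p + q) \<subseteq> ?A"
    by (rule keys_add)
  then show ?thesis
    by (simp add: laurent_subst_superset[of ?A] lookup_add coeff_fract_add distrib_right
        sum.distrib del: add_fract)
qed

lemma laurent_subst_0 [simp]: "laurent_subst y 0 = 0"
  by (simp add: laurent_subst_def)

lemma laurent_subst_sum: "laurent_subst y (\<Sum>i\<in>A. f i) = (\<Sum>i\<in>A. laurent_subst y (f i))"
  by (induction A rule: infinite_finite_induct) (auto simp: laurent_subst_add)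

lemma laurent_subst_single:
  "laurent_subst y (Poly_Mapping.single u c) = coeff_fract c * mon_subst y u"
  by (simp add: laurent_subst_superset[of "{u}"])

lemma poly_mapping_eq_sum_single:
  "p = (\<Sum>u\<in>Poly_Mapping.keys p. Poly_Mapping.single u (Poly_Mapping.lookup p u))"
  by (rule poly_mapping_eqI) (auto simp: lookup_sum lookup_single when_def in_keys_iff)

lemma laurent_subst_mult:
  assumes "\<And>k. y k \<noteq> 0"
  shows "laurent_subst y (p * q) = laurent_subst y p * laurent_subst y q"
proof -
  let ?s = "\<lambda>p u. Poly_Mapping.single u (Poly_Mapping.lookup p u) :: laurent"
  have single: "laurent_subst y (?s p u * ?s q v) = laurent_subst y (?s p u) * laurent_subst y (?s q v)"
    for u v
    by (simp add: mult_single laurent_subst_single mon_subst_add[OF assms] coeff_fract_mult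
        del: mult_fract)
  \<comment> \<open>By additivity it suffices to multiply single terms, where multiplicativity is
    \<open>mon_subst_add\<close>.\<close>
  have "p * q = (\<Sum>u\<in>Poly_Mapping.keys p. \<Sum>v\<in>Poly_Mapping.keys q. ?s p u * ?s q v)"
    by (subst (1) poly_mapping_eq_sum_single[of p], subst (1) poly_mapping_eq_sum_single[of q])
      (rule sum_product)
  then have "laurent_subst y (p * q) =
      laurent_subst y (\<Sum>u\<in>Poly_Mapping.keys p. ?s p u) * laurent_subst y (\<Sum>v\<in>Poly_Mapping.keys q. ?s q v)"
    by (simp add: laurent_subst_sum single sum_product)
  then show ?thesis
    by (simp flip: poly_mapping_eq_sum_single)
qed

lemma laurent_subst_1: "laurent_subst y 1 = 1"
  using laurent_subst_single[of y 0 1] by (simp add: fract_collapse mon_subst_def)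

text \<open>The fraction with denominator 1 supplies a value for the \<open>THE\<close>. Any other
  representation has numerator p * q', and multiplicativity makes its quotient the same.\<close>

lemma subst_Fract_1:
  assumes "\<And>k. y k \<noteq> 0"
  shows "subst y (Fract p 1) = laurent_subst y p"
  unfolding subst_def
proof (rule the_equality)
  show "\<exists>p' q'. q' \<noteq> 0 \<and> Fract p 1 = Fract p' q' \<and> laurent_subst y q' \<noteq> 0 \<and>
      laurent_subst y p = laurent_subst y p' / laurent_subst y q'"
    by (rule exI[of _ p], rule exI[of _ 1]) (simp add: laurent_subst_1)
next
  fix g
  assume "\<exists>p' q'. q' \<noteq> 0 \<and> Fract p 1 = Fract p' q' \<and> laurent_subst y q' \<noteq> 0 \<and>
      g = laurent_subst y p' / laurent_subst y q'"
  then obtain p' q' where q': "q' \<noteq> 0" and eq: "Fract p 1 = Fract p' q'"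
    and nz: "laurent_subst y q' \<noteq> 0"
    and g: "g = laurent_subst y p' / laurent_subst y q'"
    by blast
  from eq q' have "p * q' = p'"
    by (simp add: eq_fract)
  with nz show "g = laurent_subst y p"
    by (auto simp: g laurent_subst_mult[OF assms])
qed

lemma subst_sum_monomial:
  assumes "\<And>k. y k \<noteq> 0"
  shows "subst y (monomial u + (\<Sum>i\<in>A. monomial (f i))) = mon_subst y u + (\<Sum>i\<in>A. mon_subst y (f i))"
proof -
  let ?s = "\<lambda>u. Poly_Mapping.single u 1 :: laurent"
  have "(\<Sum>i\<in>A. monomial (f i)) = Fract (\<Sum>i\<in>A. ?s (f i)) 1"
    by (simp add: monomial_def Fract_sum_1)
  then have "subst y (monomial u + (\<Sum>i\<in>A. monomial (f i))) = subst y (Fract (?s u + (\<Sum>i\<in>A. ?s (f i))) 1)"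
    by (simp add: monomial_def)
  also have "\<dots> = mon_subst y u + (\<Sum>i\<in>A. mon_subst y (f i))"
    by (subst subst_Fract_1[OF assms])
      (simp add: laurent_subst_add laurent_subst_sum laurent_subst_single fract_collapse)
  finally show ?thesis .
qed

section \<open>Monomials and transition maps of single moves\<close>

lemma monomial_add: "monomial (u + v) = monomial u * monomial v"
  by (simp add: monomial_def mult_single)

lemma monomial_0 [simp]: "monomial 0 = 1"
  by (simp add: monomial_def fract_collapse)

text \<open>A monomial is a unit, with the monomial of the negated exponents as inverse.\<close>

lemma monomial_nonzero [simp]: "monomial u \<noteq> 0"
  using monomial_add[of u "-u"] by auto

lemma monomial_diff: "monomial (u - v) = monomial u / monomial v"
  using monomial_add[of "u - v" v] by (simp add: nonzero_eq_divide_eq)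

lemma var_eq_monomial: "var k = monomial (Poly_Mapping.single k 1)"
  by (simp add: var_def monomial_def)

lemma var_nonzero [simp]: "var k \<noteq> 0"
  by (simp add: var_eq_monomial)

lemma mon_subst_single [simp]: "mon_subst y (Poly_Mapping.single a 1) = y a"
  by (simp add: mon_subst_def)

abbreviation ratio :: "nat \<Rightarrow> nat \<Rightarrow> exponents" where
  "ratio a b \<equiv> Poly_Mapping.single a 1 - Poly_Mapping.single b 1"

lemma mon_subst_ratio:
  assumes "\<And>k. y k \<noteq> 0"
  shows "mon_subst y (ratio a b) = y a / y b"
  using mon_subst_add[of y "ratio a b" "Poly_Mapping.single b 1"] assms
  by (simp add: nonzero_eq_divide_eq)

section \<open>Sums of a variable and ratios of variables\<close>

definition var_sum :: "nat \<Rightarrow> (nat \<times> nat) set \<Rightarrow> ratfun" where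
  "var_sum p T = var p + (\<Sum>(a, b)\<in>T. var a / var b)"

lemma var_sum_eq_monomial:
  "var_sum p T = monomial (Poly_Mapping.single p 1) + (\<Sum>(a, b)\<in>T. monomial (ratio a b))"
  by (simp add: var_sum_def var_eq_monomial monomial_diff)

lemma subst_var_sum:
  assumes "\<And>k. y k \<noteq> 0"
  shows "subst y (var_sum p T) = y p + (\<Sum>(a, b)\<in>T. y a / y b)"
  using subst_sum_monomial[of y "Poly_Mapping.single p 1" "\<lambda>(a, b). ratio a b" T]
  by (simp add: var_sum_eq_monomial case_prod_unfold assms mon_subst_ratio)

lemma two_term_map_nonzero: "two_term_map l k \<noteq> 0"
  by (simp add: two_term_map_def)

text \<open>The coefficient at u is 1, or 2 if u = v; in characteristic 0 neither vanishes.\<close>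

lemma monomial_sum_nonzero: "monomial u + monomial v \<noteq> 0"
proof -
  let ?s = "\<lambda>u. Poly_Mapping.single u 1 :: laurent"
  have "Poly_Mapping.lookup (?s u + ?s v) u \<noteq> 0"
    by (simp add: lookup_add lookup_single when_def)
  then have "?s u + ?s v \<noteq> 0"
    by (metis lookup_zero)
  then show ?thesis
    by (simp add: monomial_def eq_fract Zero_fract_def)
qed

text \<open>Both sums occurring in the map are sums of two monomials. Nonvanishing is the condition
  under which substitution is multiplicative.\<close>

lemma three_term_map_nonzero: "three_term_map l k \<noteq> 0"
proof -
  have "var (l + 1) + var l * var (l + 2) \<noteq> 0" "var l + var (l + 1) / var (l + 2) \<noteq> 0"
    unfolding var_eq_monomial
    by (simp_all only: monomial_sum_nonzero not_False_eq_True flip: monomial_add monomial_diff)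
  then show ?thesis
    by (simp add: three_term_map_def)
qed

lemma laurent_subst_var: "laurent_subst var p = Fract p 1"
proof -
  have mon: "mon_subst var u = monomial u" for u
  proof -
    \<comment> \<open>Natural powers follow by induction, negative ones by inverting the
      monomial.\<close>
    have pw: "var k powi m = monomial (Poly_Mapping.single k m)" for k m
    proof (cases m rule: int_cases2)
      case (nonneg j)
      have "var k ^ j = monomial (Poly_Mapping.single k (int j))"
        by (induction j) (simp_all add: var_eq_monomial single_add monomial_add)
      with nonneg show ?thesis by simp
    next
      case (nonpos j)
      have "var k ^ j = monomial (Poly_Mapping.single k (int j))"
        by (induction j) (simp_all add: var_eq_monomial single_add monomial_add)
      moreover have "monomial (Poly_Mapping.single k (- int j)) = inverse (monomial (Poly_Mapping.single k (int j)))"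
        using monomial_diff[of 0 "Poly_Mapping.single k (int j)"]
        by (simp add: single_uminus divide_inverse)
      ultimately show ?thesis using nonpos
        by (simp add: power_int_minus)
    qed
    have "monomial (\<Sum>k\<in>A. f k) = (\<Prod>k\<in>A. monomial (f k))" for A :: "nat set" and f
      by (induction A rule: infinite_finite_induct) (simp_all add: monomial_add)
    then show ?thesis
      unfolding mon_subst_def pw
      by (metis poly_mapping_eq_sum_single)
  qed
  have "Fract (Poly_Mapping.single u c) 1 = coeff_fract c * monomial u" for u c
    by (simp add: monomial_def mult_single)
  then show ?thesis
    unfolding laurent_subst_eq mon by (metis (no_types, lifting) Fract_sum_1 poly_mapping_eq_sum_single sum.cong)
qed

text \<open>Every \<open>transition\<close> starts from the identity map \<open>var\<close>; this
  removes the trivial composition from a transition that consists of one move.\<close>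

lemma subst_var: "subst var f = f"
  unfolding subst_def
proof (rule the_equality)
  obtain p q where "q \<noteq> 0" "f = Fract p q"
    by (cases f)
  then show "\<exists>p q. q \<noteq> 0 \<and> f = Fract p q \<and> laurent_subst var q \<noteq> 0 \<and>
      f = laurent_subst var p / laurent_subst var q"
    by (intro exI[of _ p] exI[of _ q]) (simp add: laurent_subst_var eq_fract Zero_fract_def)
qed (auto simp: laurent_subst_var)

lemma transition_two_term: "two_term_move \<alpha> l w w' \<Longrightarrow> transition \<alpha> w w' (two_term_map l)"
  using transition.two[OF transition.refl, of \<alpha> l w w'] by (simp add: subst_var)

lemma transition_three_term: "three_term_move \<alpha> l w w' \<Longrightarrow> transition \<alpha> w w' (three_term_map l)"
  using transition.three[OF transition.refl, of \<alpha> l w w'] by (simp add: subst_var)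

text \<open>The map only swaps two variables, so it acts on indices by a transposition. That is
  injective on pairs, hence no two summands of T are merged.\<close>

lemma subst_two_term_var_sum:
  assumes "finite T"
  shows "subst (two_term_map l) (var_sum p T) =
    var_sum (Transposition.transpose l (l + 1) p) (map_prod (Transposition.transpose l (l + 1)) (Transposition.transpose l (l + 1)) ` T)"
proof -
  let ?s = "Transposition.transpose l (l + 1)"
  have s: "two_term_map l k = var (?s k)" for k
    by (simp add: two_term_map_def Transposition.transpose_def)
  have "inj_on (map_prod ?s ?s) T"
    by (intro inj_on_subset[OF prod.inj_map]) auto
  then show ?thesis
    by (simp add: subst_var_sum two_term_map_nonzero)
      (simp add: s var_sum_def sum.reindex case_prod_unfold)
qed

lemma subst_three_term_var_sum:
  assumes "finite T" and "\<And>a b. (a, b) \<in> T \<Longrightarrow> a > l + 2 \<and> b > l + 2"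
  shows "subst (three_term_map l) (var_sum (l + 2) T) = var_sum l (insert (l + 1, l + 2) T)"
proof -
  have "(\<Sum>(a, b)\<in>T. three_term_map l a / three_term_map l b) = (\<Sum>(a, b)\<in>T. var a / var b)"
    by (rule sum.cong) (use assms(2) in \<open>force simp: three_term_map_def\<close>)+
  \<comment> \<open>The new ratio is not among the old ones, so inserting its pair adds exactly one
    summand.\<close>
  moreover have "(l + 1, l + 2) \<notin> T"
    using assms(2) by force
  moreover have "three_term_map l (l + 2) = var l + var (l + 1) / var (l + 2)"
    by (simp add: three_term_map_def)
  ultimately show ?thesis
    by (simp only: subst_var_sum three_term_map_nonzero not_False_eq_True)
      (simp add: var_sum_def \<open>finite T\<close>)
qed

text \<open>An inclusion is enough: exponents have to be bounded, and edges found, only for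
  monomials that do occur.\<close>

lemma monomials_var_sum:
  "is_laurent (var_sum p T)"
  "monomials (var_sum p T) \<subseteq> insert (Poly_Mapping.single p 1) ((\<lambda>(a, b). ratio a b) ` T)"
proof -
  define P :: laurent where
    "P = Poly_Mapping.single (Poly_Mapping.single p 1) 1 + (\<Sum>(a, b)\<in>T. Poly_Mapping.single (ratio a b) 1)"
  have eq: "var_sum p T = Fract P 1"
    by (simp add: var_sum_eq_monomial monomial_def P_def Fract_add_1 Fract_sum_1 case_prod_unfold del: add_fract)
  then show "is_laurent (var_sum p T)"
    by (auto simp: is_laurent_def)
  have "Poly_Mapping.keys (\<Sum>(a, b)\<in>T. Poly_Mapping.single (ratio a b) (1 :: complex)) \<subseteq> (\<lambda>(a, b). ratio a b) ` T"
    using keys_sum[of "\<lambda>(a, b). Poly_Mapping.single (ratio a b) (1 :: complex)" T]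
    by (fastforce split: if_splits)
  then have "Poly_Mapping.keys P \<subseteq> insert (Poly_Mapping.single p 1) ((\<lambda>(a, b). ratio a b) ` T)"
    unfolding P_def using keys_add by fastforce
  then show "monomials (var_sum p T) \<subseteq> insert (Poly_Mapping.single p 1) ((\<lambda>(a, b). ratio a b) ` T)"
    by (auto simp: monomials_def eq eq_fract)
qed

lemma multiplicity_free_var_sum: "multiplicity_free (var_sum p T)"
  unfolding multiplicity_free_def
  using monomials_var_sum[of p T]
  by (fastforce simp: lookup_single lookup_minus when_def)

section \<open>Linear forms and a criterion for non-redundancy\<close>

lemma linear_form_single [simp]: "linear_form (Poly_Mapping.single p 1) t = t p"
  by (simp add: linear_form_def)

lemma linear_form_ratio: "a \<noteq> b \<Longrightarrow> linear_form (ratio a b) t = t a - t b"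
proof -
  assume "a \<noteq> b"
  then have "Poly_Mapping.keys (ratio a b) = {a, b}"
    by (auto simp: in_keys_iff lookup_minus lookup_single when_def split: if_splits)
  with \<open>a \<noteq> b\<close> show ?thesis
    by (simp add: linear_form_def lookup_minus lookup_single)
qed

text \<open>The easy direction of Farkas' lemma: at such a point t any non-negative combination of
  the other forms is non-negative, while the form of m is negative.\<close>

lemma not_redundantI:
  assumes "\<And>m. m \<in> M \<Longrightarrow> \<exists>t. L m t < 0 \<and> (\<forall>m' \<in> M - {m}. 0 \<le> L m' t)"
  shows "\<not> redundant M L"
proof
  assume "redundant M L"
  then obtain m c where m: "m \<in> M" and c: "\<And>m'. m' \<in> M - {m} \<Longrightarrow> 0 \<le> c m'"
    and eq: "\<And>t. L m t = (\<Sum>m'\<in>M - {m}. c m' * L m' t)"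
    unfolding redundant_def by blast
  obtain t where "L m t < 0" "\<forall>m' \<in> M - {m}. 0 \<le> L m' t"
    using assms[OF m] by blast
  moreover from this c have "0 \<le> (\<Sum>m'\<in>M - {m}. c m' * L m' t)"
    by (intro sum_nonneg mult_nonneg_nonneg) auto
  ultimately show False
    using eq[of t] by simp
qed

section \<open>Root systems and reduced words\<close>

lemma linear_reflection: "linear (reflection a)"
proof (rule linearI)
  show "reflection a (x + y) = reflection a x + reflection a y" for x y
    by (simp add: reflection_def inner_add_right distrib_left add_divide_distrib scaleR_add_left)
  show "reflection a (c *\<^sub>R x) = c *\<^sub>R reflection a x" for c x
    by (simp add: reflection_def scaleR_diff_right mult.left_commute)
qed

lemma reflection_self: "a \<noteq> 0 \<Longrightarrow> reflection a a = - a"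
  by (simp add: reflection_def algebra_simps scaleR_2)

lemma reflection_involutive [simp]: "reflection a (reflection a v) = v"
  by (cases "a = 0") (simp_all add: reflection_def inner_diff_right algebra_simps)

lemma reflection_uminus [simp]: "reflection (- a) = reflection a"
  by (simp add: reflection_def fun_eq_iff)

lemma orthogonal_transformation_reflection: "orthogonal_transformation (reflection a)"
  unfolding orthogonal_transformation_def
proof (intro conjI allI linear_reflection)
  show "reflection a v \<bullet> reflection a w = v \<bullet> w" for v w
    by (cases "a = 0")
      (simp_all add: reflection_def inner_diff_right inner_diff_left inner_commute[of v a])
qed

text \<open>Source of the deletion argument as well as of the commutation and braid
  relations.\<close>

lemma reflection_conjugate:
  "orthogonal_transformation g \<Longrightarrow> reflection (g a) (g x) = g (reflection a x)"
  by (simp add: reflection_def orthogonal_transformation_def linear_diff linear_cmul)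

lemma word_act_Nil [simp]: "word_act \<alpha> [] = id"
  by (simp add: word_act_def)

lemma word_act_Cons: "word_act \<alpha> (i # w) = reflection (\<alpha> i) \<circ> word_act \<alpha> w"
  by (simp add: word_act_def)

lemma word_act_append: "word_act \<alpha> (u @ v) = word_act \<alpha> u \<circ> word_act \<alpha> v"
  by (induction u) (auto simp: word_act_Cons)

lemma orthogonal_transformation_word_act: "orthogonal_transformation (word_act \<alpha> w)"
proof (induction w)
  case (Cons i w)
  then show ?case
    unfolding word_act_Cons
    by (intro orthogonal_transformation_compose orthogonal_transformation_reflection)
qed (simp add: id_def orthogonal_transformation_id)

lemmas linear_word_act = orthogonal_transformation_word_act[THEN orthogonal_transformation_linear]

lemma word_act_inner [simp]: "word_act \<alpha> w x \<bullet> word_act \<alpha> w y = x \<bullet> y"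
  using orthogonal_transformation_word_act[of \<alpha> w] by (simp add: orthogonal_transformation_def)

lemma word_act_uminus: "word_act \<alpha> w (- x) = - word_act \<alpha> w x"
  by (rule linear_neg[OF linear_word_act])

section \<open>Words and reduced words\<close>

lemma words_append [simp]: "u @ v \<in> words n \<longleftrightarrow> u \<in> words n \<and> v \<in> words n"
  by (auto simp: words_def)

lemma words_Cons [simp]: "i # v \<in> words n \<longleftrightarrow> i \<in> {1..n} \<and> v \<in> words n"
  by (auto simp: words_def)

lemma words_Nil [simp]: "[] \<in> words n"
  by (simp add: words_def)

text \<open>Stated by comparison with all words for the same element, so that non-reducedness is
  shown by exhibiting a shorter word. \<open>reduced_eq_weyl_length\<close> gives the link to
  \<open>weyl_length\<close>.\<close>

definition reduced :: "nat \<Rightarrow> (nat \<Rightarrow> 'a::real_inner) \<Rightarrow> nat list \<Rightarrow> bool" where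
  "reduced n \<alpha> w \<longleftrightarrow>
     w \<in> words n \<and> (\<forall>v \<in> words n. word_act \<alpha> v = word_act \<alpha> w \<longrightarrow> length w \<le> length v)"

lemma reduced_in_words: "reduced n \<alpha> w \<Longrightarrow> w \<in> words n"
  by (simp add: reduced_def)

lemma weyl_length_le: "v \<in> words n \<Longrightarrow> weyl_length n \<alpha> (word_act \<alpha> v) \<le> length v"
  unfolding weyl_length_def by (rule Least_le) auto

lemma weyl_length_attained:
  assumes "g \<in> weyl_group n \<alpha>"
  shows "\<exists>w\<in>words n. length w = weyl_length n \<alpha> g \<and> word_act \<alpha> w = g"
proof -
  let ?P = "\<lambda>k. \<exists>w\<in>words n. length w = k \<and> word_act \<alpha> w = g"
  have "\<exists>k. ?P k"
    using assms by (auto simp: weyl_group_def)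
  then have "?P (LEAST k. ?P k)"
    by (rule LeastI_ex)
  then show ?thesis
    by (simp add: weyl_length_def)
qed

lemma reduced_eq_weyl_length:
  "reduced n \<alpha> w \<longleftrightarrow> w \<in> words n \<and> length w = weyl_length n \<alpha> (word_act \<alpha> w)"
proof (intro iffI)
  assume r: "reduced n \<alpha> w"
  then obtain v where "v \<in> words n" "length v = weyl_length n \<alpha> (word_act \<alpha> w)"
    "word_act \<alpha> v = word_act \<alpha> w"
    using weyl_length_attained[of "word_act \<alpha> w" n \<alpha>] by (auto simp: reduced_def weyl_group_def)
  then have "length w \<le> weyl_length n \<alpha> (word_act \<alpha> w)"
    using r unfolding reduced_def by metis
  then show "w \<in> words n \<and> length w = weyl_length n \<alpha> (word_act \<alpha> w)"
    using reduced_in_words[OF r] weyl_length_le[of w n \<alpha>] by simp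
next
  assume "w \<in> words n \<and> length w = weyl_length n \<alpha> (word_act \<alpha> w)"
  then show "reduced n \<alpha> w"
    unfolding reduced_def by (metis weyl_length_le)
qed

lemma reduced_word_exists:
  assumes "g \<in> weyl_group n \<alpha>"
  obtains w where "reduced n \<alpha> w" "word_act \<alpha> w = g"
  using weyl_length_attained[OF assms] that by (auto simp: reduced_eq_weyl_length)

text \<open>A shorter word for u, followed by v, would be a shorter word for the whole
  product.\<close>

lemma reduced_prefix:
  assumes "reduced n \<alpha> (u @ v)"
  shows "reduced n \<alpha> u"
  unfolding reduced_def
proof (intro conjI ballI impI)
  show "u \<in> words n"
    using assms by (simp add: reduced_def)
  fix u' assume "u' \<in> words n" "word_act \<alpha> u' = word_act \<alpha> u"
  then show "length u \<le> length u'"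
    using assms unfolding reduced_def
    by (auto dest!: bspec[of _ _ "u' @ v"] simp: word_act_append)
qed

text \<open>The reflections in \<open>\<alpha> a\<close> and in \<open>- \<alpha> a\<close> agree, so both signs lead to the same deletion.\<close>

lemma not_reduced_deletion:
  assumes "word_act \<alpha> v (\<alpha> b) \<in> {\<alpha> a, - \<alpha> a}"
  shows "\<not> reduced n \<alpha> (u @ [a] @ v @ [b] @ x)"
proof
  assume r: "reduced n \<alpha> (u @ [a] @ v @ [b] @ x)"
  have "reflection (\<alpha> a) (word_act \<alpha> v y) = word_act \<alpha> v (reflection (\<alpha> b) y)" for y
    using assms reflection_conjugate[OF orthogonal_transformation_word_act, of \<alpha> v "\<alpha> b" y] by auto
  then have "word_act \<alpha> (u @ [a] @ v @ [b] @ x) = word_act \<alpha> (u @ v @ x)"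
    by (simp add: word_act_append word_act_Cons fun_eq_iff)
  with r have "length (u @ [a] @ v @ [b] @ x) \<le> length (u @ v @ x)"
    unfolding reduced_def by (auto dest!: bspec[of _ _ "u @ v @ x"])
  then show False
    by simp
qed

lemma word_root_append [simp]: "word_root \<alpha> (u @ a # v) (length u) = word_act \<alpha> u (\<alpha> a)"
  by (simp add: word_root_def)

text \<open>Let v be the part of w strictly between positions j < k. If the roots agree, cancelling
  the prefix before j shows that v sends the simple root of letter k to minus that of letter j. Then
  both letters can be deleted, against reducedness.\<close>

lemma word_root_inj:
  assumes r: "reduced n \<alpha> w" and nz: "\<And>i. i \<in> {1..n} \<Longrightarrow> \<alpha> i \<noteq> 0"
    and jk: "j < length w" "k < length w" and eq: "word_root \<alpha> w j = word_root \<alpha> w k"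
  shows "j = k"
proof -
  have False if "j < k" "k < length w" and eq: "word_root \<alpha> w j = word_root \<alpha> w k" for j k
  proof -
    define v where "v = drop (Suc j) (take k w)"
    have tk: "take k w = take j w @ [w ! j] @ v"
      using id_take_nth_drop[of j "take k w"] that by (simp add: v_def min_def)
    have w: "w = take j w @ [w ! j] @ v @ [w ! k] @ drop (Suc k) w"
      using id_take_nth_drop[OF that(2)] unfolding tk by simp
    have "w ! j \<in> {1..n}"
      using that reduced_in_words[OF r] nth_mem[of j w] by (auto simp: words_def simp del: nth_mem)
    have "word_act \<alpha> (take j w) (\<alpha> (w ! j)) =
        word_act \<alpha> (take j w) (reflection (\<alpha> (w ! j)) (word_act \<alpha> v (\<alpha> (w ! k))))"
      using eq unfolding word_root_def tk by (simp add: word_act_append word_act_Cons)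
    then have "\<alpha> (w ! j) = reflection (\<alpha> (w ! j)) (word_act \<alpha> v (\<alpha> (w ! k)))"
      using orthogonal_transformation_inj[OF orthogonal_transformation_word_act] by (auto dest: injD)
    then have "word_act \<alpha> v (\<alpha> (w ! k)) = reflection (\<alpha> (w ! j)) (\<alpha> (w ! j))"
      by (metis reflection_involutive)
    also have "\<dots> = - \<alpha> (w ! j)"
      using nz \<open>w ! j \<in> {1..n}\<close> by (simp add: reflection_self)
    finally show False
      using not_reduced_deletion[of \<alpha> v "w ! k" "w ! j" n "take j w" "drop (Suc k) w"] r w by simp
  qed
  then show ?thesis
    using jk eq by (metis linorder_neqE_nat)
qed

locale simple_root_system =
  fixes \<Phi> :: "'a::euclidean_space set" and n :: nat and \<alpha> :: "nat \<Rightarrow> 'a"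
  assumes root_system: "root_system \<Phi>" and simple_roots: "simple_roots \<Phi> n \<alpha>"
begin

lemma finite_roots: "finite \<Phi>" and span_roots: "span \<Phi> = UNIV"
  using root_system unfolding root_system_def by blast+

lemma root_nonzero: "a \<in> \<Phi> \<Longrightarrow> a \<noteq> 0"
  using root_system unfolding root_system_def by blast

lemma reflection_root: "a \<in> \<Phi> \<Longrightarrow> b \<in> \<Phi> \<Longrightarrow> reflection a b \<in> \<Phi>"
  using root_system unfolding root_system_def by blast

lemma root_multiple: "a \<in> \<Phi> \<Longrightarrow> r *\<^sub>R a \<in> \<Phi> \<Longrightarrow> r = 1 \<or> r = - 1"
  using root_system unfolding root_system_def by blast

lemma simple_root: "i \<in> {1..n} \<Longrightarrow> \<alpha> i \<in> \<Phi>"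
  using simple_roots unfolding simple_roots_def by auto

lemma simple_root_nonzero: "i \<in> {1..n} \<Longrightarrow> \<alpha> i \<noteq> 0"
  using simple_root root_nonzero by blast

lemma simple_root_inj: "i \<in> {1..n} \<Longrightarrow> j \<in> {1..n} \<Longrightarrow> \<alpha> i = \<alpha> j \<longleftrightarrow> i = j"
  using simple_roots unfolding simple_roots_def by (blast dest: inj_onD)

lemma uminus_root: "a \<in> \<Phi> \<Longrightarrow> - a \<in> \<Phi>"
  using reflection_root[of a a] reflection_self[of a] root_nonzero by auto

lemma word_act_root: "w \<in> words n \<Longrightarrow> b \<in> \<Phi> \<Longrightarrow> word_act \<alpha> w b \<in> \<Phi>"
  by (induction w) (auto simp: word_act_Cons intro!: reflection_root simple_root)

section \<open>Coordinates with respect to the simple roots, and positive roots\<close>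

definition coord :: "nat \<Rightarrow> 'a \<Rightarrow> real" where
  "coord j = (SOME f. linear f \<and> (\<forall>k\<in>{1..n}. f (\<alpha> k) = (if k = j then 1 else 0)))"

lemma coord: "linear (coord j)" "k \<in> {1..n} \<Longrightarrow> coord j (\<alpha> k) = (if k = j then 1 else 0)"
proof -
  have "independent (\<alpha> ` {1..n})" and inj: "inj_on \<alpha> {1..n}"
    using simple_roots unfolding simple_roots_def by blast+
  \<comment> \<open>The extension theorem prescribes values on vectors, so the index of a simple
    root is recovered by inverting \<alpha> on its index set.\<close>
  then obtain f :: "'a \<Rightarrow> real" where "linear f"
    and f: "\<forall>x\<in>\<alpha> ` {1..n}. f x = (if the_inv_into {1..n} \<alpha> x = j then 1 else 0)"
    using linear_independent_extend[of "\<alpha> ` {1..n}"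
        "\<lambda>x. if the_inv_into {1..n} \<alpha> x = j then 1 else 0"] by metis
  have "f (\<alpha> k) = (if k = j then 1 else 0)" if "k \<in> {1..n}" for k
    using f that by (simp only: ball_simps the_inv_into_f_f[OF inj])
  with \<open>linear f\<close> have "\<exists>f::'a \<Rightarrow> real. linear f \<and> (\<forall>k\<in>{1..n}. f (\<alpha> k) = (if k = j then 1 else 0))"
    by (intro exI[of _ f]) simp
  then have "linear (coord j) \<and> (\<forall>k\<in>{1..n}. coord j (\<alpha> k) = (if k = j then 1 else 0))"
    unfolding coord_def by (rule someI_ex)
  then show "linear (coord j)" "k \<in> {1..n} \<Longrightarrow> coord j (\<alpha> k) = (if k = j then 1 else 0)"
    by auto
qed

lemma coord_sum:
  assumes "j \<in> {1..n}"
  shows "coord j (\<Sum>i\<in>{1..n}. c i *\<^sub>R \<alpha> i) = c j"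
proof -
  have "coord j (\<Sum>i\<in>{1..n}. c i *\<^sub>R \<alpha> i) = (\<Sum>i\<in>{1..n}. c i * coord j (\<alpha> i))"
    by (simp add: linear_sum[OF coord(1)] linear_cmul[OF coord(1)])
  also have "\<dots> = (\<Sum>i\<in>{1..n}. if i = j then c j else 0)"
    by (rule sum.cong) (auto simp: coord(2))
  finally show ?thesis
    using assms by simp
qed

lemma coord_uminus: "coord j (- b) = - coord j b"
  by (rule linear_neg[OF coord(1)])

text \<open>Only signs of real coordinates are asked for; \<open>positive_nat_coeffs\<close>
  recovers the natural coefficients.\<close>

definition positive :: "'a \<Rightarrow> bool" where
  "positive b \<longleftrightarrow> b \<in> \<Phi> \<and> (\<forall>i\<in>{1..n}. 0 \<le> coord i b)"

lemma root_nat_coeffs: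
  assumes "b \<in> \<Phi>"
  obtains m :: "nat \<Rightarrow> nat"
  where "b = (\<Sum>i\<in>{1..n}. real (m i) *\<^sub>R \<alpha> i)"
  | m :: "nat \<Rightarrow> nat" where "- b = (\<Sum>i\<in>{1..n}. real (m i) *\<^sub>R \<alpha> i)"
proof -
  obtain m :: "nat \<Rightarrow> nat" where
    "b = (\<Sum>i\<in>{1..n}. real (m i) *\<^sub>R \<alpha> i) \<or> b = - (\<Sum>i\<in>{1..n}. real (m i) *\<^sub>R \<alpha> i)"
    using simple_roots assms unfolding simple_roots_def by blast
  then show ?thesis
    using that by (metis minus_minus)
qed

lemma root_cases:
  assumes "b \<in> \<Phi>"
  shows "positive b \<or> positive (- b)"
  using assms
proof (cases rule: root_nat_coeffs)
  case (1 m)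
  then have "coord i b = real (m i)" if "i \<in> {1..n}" for i
    using that by (simp only: coord_sum)
  then show ?thesis
    using assms by (simp add: positive_def)
next
  case (2 m)
  then have "coord i (- b) = real (m i)" if "i \<in> {1..n}" for i
    using that by (simp only: coord_sum)
  then show ?thesis
    using assms uminus_root by (simp add: positive_def)
qed

lemma root_expansion:
  assumes "b \<in> \<Phi>"
  shows "b = (\<Sum>i\<in>{1..n}. coord i b *\<^sub>R \<alpha> i)"
proof -
  obtain c where c: "b = (\<Sum>i\<in>{1..n}. c i *\<^sub>R \<alpha> i)"
    using assms
  proof (cases rule: root_nat_coeffs)
    case (2 m)
    then have "b = (\<Sum>i\<in>{1..n}. (- real (m i)) *\<^sub>R \<alpha> i)"
      by (simp only: scaleR_minus_left sum_negf) (metis minus_minus)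
    then show ?thesis
      by (rule that)
  qed (rule that)
  have "coord i b = c i" if "i \<in> {1..n}" for i
    using that unfolding c by (rule coord_sum)
  then have "(\<Sum>i\<in>{1..n}. coord i b *\<^sub>R \<alpha> i) = (\<Sum>i\<in>{1..n}. c i *\<^sub>R \<alpha> i)"
    by (intro sum.cong) auto
  then show ?thesis
    using c by simp
qed

lemma positive_not_negative: "positive b \<Longrightarrow> \<not> positive (- b)"
proof
  assume b: "positive b" "positive (- b)"
  have "coord i b = 0" if "i \<in> {1..n}" for i
    using b that unfolding positive_def by (fastforce simp: coord_uminus)
  then have "(\<Sum>i\<in>{1..n}. coord i b *\<^sub>R \<alpha> i) = 0"
    by simp
  moreover have "b \<in> \<Phi>"
    using b by (simp add: positive_def)
  ultimately have "b = 0"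
    using root_expansion by metis
  then show False
    using b root_nonzero by (auto simp: positive_def)
qed

lemma positive_simple_root: "i \<in> {1..n} \<Longrightarrow> positive (\<alpha> i)"
  by (simp add: positive_def simple_root coord(2))

lemma positive_nat_coeffs:
  assumes "positive b"
  obtains m :: "nat \<Rightarrow> nat" where "b = (\<Sum>i\<in>{1..n}. real (m i) *\<^sub>R \<alpha> i)"
proof -
  have "b \<in> \<Phi>"
    using assms by (simp add: positive_def)
  then show ?thesis
  proof (cases rule: root_nat_coeffs)
    case (2 m)
    have "coord i (- b) = real (m i)" if "i \<in> {1..n}" for i
      using that unfolding 2 by (rule coord_sum)
    then have "positive (- b)"
      using uminus_root[OF \<open>b \<in> \<Phi>\<close>] by (simp add: positive_def)
    then show ?thesis
      using positive_not_negative[OF assms] by blast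
  qed (rule that)
qed

text \<open>The reflection changes only coordinate i. A positive root other than
  \<open>\<alpha> i\<close> has a further nonzero coordinate, which stays positive, and one positive
  coordinate excludes a negative root.\<close>

lemma positive_reflection:
  assumes "positive b" "i \<in> {1..n}" "b \<noteq> \<alpha> i"
  shows "positive (reflection (\<alpha> i) b)"
proof -
  have b_root: "b \<in> \<Phi>"
    using assms by (simp add: positive_def)
  have "\<exists>j\<in>{1..n}. j \<noteq> i \<and> coord j b \<noteq> 0"
  \<comment> \<open>Otherwise b is a multiple of \<open>\<alpha> i\<close>, hence plus or minus
    \<open>\<alpha> i\<close>, and positivity leaves \<open>\<alpha> i\<close> itself.\<close>
  proof (rule ccontr)
    assume "\<not> ?thesis"
    then have "(\<Sum>j\<in>{1..n}. coord j b *\<^sub>R \<alpha> j) = (\<Sum>j\<in>{1..n}. if j = i then coord i b *\<^sub>R \<alpha> i else 0)"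
      by (intro sum.cong) auto
    also have "\<dots> = coord i b *\<^sub>R \<alpha> i"
      using assms(2) by simp
    finally have b: "b = coord i b *\<^sub>R \<alpha> i"
      using root_expansion b_root by metis
    then have "coord i b = 1 \<or> coord i b = - 1"
      using root_multiple[of "\<alpha> i" "coord i b"] b_root simple_root[OF assms(2)] by metis
    moreover have "coord i b \<ge> 0"
      using assms by (simp add: positive_def)
    ultimately have "coord i b = 1"
      by linarith
    then have "b = \<alpha> i"
      using b by (metis scaleR_one)
    then show False
      using assms by simp
  qed
  then obtain j where j: "j \<in> {1..n}" "j \<noteq> i" "coord j b \<noteq> 0"
    by blast
  have "coord j (reflection (\<alpha> i) b) = coord j b"
    using assms j by (simp add: reflection_def linear_diff[OF coord(1)] linear_cmul[OF coord(1)] coord(2))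
  then have "\<not> positive (- reflection (\<alpha> i) b)"
    using j assms unfolding positive_def by (force simp: coord_uminus)
  then show ?thesis
    using root_cases reflection_root simple_root assms unfolding positive_def by blast
qed

text \<open>The letters of w are applied to \<open>\<alpha> i\<close> one at a time, starting with
  the last. A letter j can destroy positivity only if the current root is \<open>\<alpha> j\<close>,
  and then j and the final i could be deleted.\<close>

lemma reduced_snoc_positive:
  assumes r: "reduced n \<alpha> (w @ [i])"
  shows "positive (word_act \<alpha> w (\<alpha> i))"
proof -
  have i: "i \<in> {1..n}"
    using reduced_in_words[OF r] by simp
  have "positive (word_act \<alpha> v (\<alpha> i))" if "w = u @ v" for u v
    using that
  proof (induction v arbitrary: u)
    case Nil
    then show ?case
      using positive_simple_root[OF i] by simp
  next
    case (Cons j v)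
    have pos: "positive (word_act \<alpha> v (\<alpha> i))"
      using Cons.IH[of "u @ [j]"] Cons.prems by simp
    have "word_act \<alpha> v (\<alpha> i) \<noteq> \<alpha> j"
      using not_reduced_deletion[of \<alpha> v i j n u "[]"] r Cons.prems by auto
    moreover have "j \<in> {1..n}"
      using reduced_in_words[OF r] Cons.prems by simp
    ultimately show ?case
      using positive_reflection[OF pos] by (simp add: word_act_Cons)
  qed
  then show ?thesis
    by simp
qed

section \<open>Inversions, length and the longest element\<close>

definition inversions :: "('a \<Rightarrow> 'a) \<Rightarrow> 'a set" where
  "inversions g = {b. positive b \<and> positive (- g b)}"

lemma finite_inversions: "finite (inversions g)"
  by (rule finite_subset[OF _ finite_roots]) (auto simp: inversions_def positive_def)

lemma simple_reflection_self: "i \<in> {1..n} \<Longrightarrow> reflection (\<alpha> i) (\<alpha> i) = - \<alpha> i"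
  by (simp add: reflection_self simple_root_nonzero)

lemma inversions_id [simp]: "inversions (\<lambda>b. b) = {}"
  using positive_not_negative by (auto simp: inversions_def)

text \<open>The simple reflection permutes the positive roots other than \<open>\<alpha> i\<close>.
  So the inversions of the longer word are the reflected old ones together with
  \<open>\<alpha> i\<close>, which is new.\<close>

lemma card_inversions_snoc:
  assumes "w \<in> words n" "i \<in> {1..n}" "positive (word_act \<alpha> w (\<alpha> i))"
  shows "card (inversions (word_act \<alpha> (w @ [i]))) = Suc (card (inversions (word_act \<alpha> w)))"
proof -
  let ?I = "inversions (word_act \<alpha> w)"
  have notin: "\<alpha> i \<notin> ?I"
    using assms positive_not_negative by (auto simp: inversions_def)
  have "\<alpha> i \<notin> reflection (\<alpha> i) ` ?I"
  proof
    assume "\<alpha> i \<in> reflection (\<alpha> i) ` ?I"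
    then have "- \<alpha> i \<in> ?I"
      using simple_reflection_self[OF assms(2)] by (metis imageE reflection_involutive)
    then show False
      using positive_not_negative positive_simple_root[OF assms(2)] by (auto simp: inversions_def)
  qed
  moreover have "inversions (word_act \<alpha> (w @ [i])) = insert (\<alpha> i) (reflection (\<alpha> i) ` ?I)"
  proof (intro equalityI subsetI)
    fix b assume "b \<in> inversions (word_act \<alpha> (w @ [i]))"
    then have b: "positive b" "positive (- word_act \<alpha> w (reflection (\<alpha> i) b))"
      by (auto simp: inversions_def word_act_append word_act_Cons)
    then have "reflection (\<alpha> i) b \<in> ?I" if "b \<noteq> \<alpha> i"
      using that assms positive_reflection by (simp add: inversions_def)
    then show "b \<in> insert (\<alpha> i) (reflection (\<alpha> i) ` ?I)"
      by (metis image_eqI insertCI reflection_involutive)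
  next
    fix b assume b: "b \<in> insert (\<alpha> i) (reflection (\<alpha> i) ` ?I)"
    show "b \<in> inversions (word_act \<alpha> (w @ [i]))"
    proof (cases "b = \<alpha> i")
      case True
      then show ?thesis
        using assms positive_simple_root simple_reflection_self
        by (simp add: inversions_def word_act_append word_act_Cons word_act_uminus)
    next
      case False
      then obtain c where c: "c \<in> ?I" "b = reflection (\<alpha> i) c"
        using b by blast
      moreover have "positive b"
        using c notin assms(2) by (auto simp: inversions_def intro!: positive_reflection)
      ultimately show ?thesis
        by (simp add: inversions_def word_act_append word_act_Cons)
    qed
  qed
  moreover have "card (reflection (\<alpha> i) ` ?I) = card ?I"
    by (intro card_image inj_onI) (metis reflection_involutive)
  ultimately show ?thesis
    by (simp add: finite_inversions)
qed

lemma card_inversions_reduced: "reduced n \<alpha> w \<Longrightarrow> card (inversions (word_act \<alpha> w)) = length w"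
proof (induction w rule: rev_induct)
  case Nil
  then show ?case
    by simp
next
  case (snoc i w)
  then show ?case
    using card_inversions_snoc[of w i] reduced_snoc_positive reduced_prefix reduced_in_words by fastforce
qed

lemma weyl_length_eq_card_inversions:
  "g \<in> weyl_group n \<alpha> \<Longrightarrow> weyl_length n \<alpha> g = card (inversions g)"
  using card_inversions_reduced reduced_eq_weyl_length by (metis reduced_word_exists)

text \<open>The \<open>ARG_MAX\<close> in the definition is attained because lengths are bounded:
  inversions are roots, and there are finitely many roots.\<close>

lemma longest_element:
  "longest_element n \<alpha> \<in> weyl_group n \<alpha>"
  "g \<in> weyl_group n \<alpha> \<Longrightarrow> weyl_length n \<alpha> g \<le> weyl_length n \<alpha> (longest_element n \<alpha>)"
proof -
  have id: "id \<in> weyl_group n \<alpha>"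
    unfolding weyl_group_def by (metis image_eqI word_act_Nil words_Nil)
  have "card (inversions g) \<le> card \<Phi>" for g
    by (intro card_mono finite_roots) (auto simp: inversions_def positive_def)
  then have bound: "\<forall>g. g \<in> weyl_group n \<alpha> \<longrightarrow> weyl_length n \<alpha> g < Suc (card \<Phi>)"
    by (simp add: weyl_length_eq_card_inversions le_imp_less_Suc)
  show "longest_element n \<alpha> \<in> weyl_group n \<alpha>"
    "g \<in> weyl_group n \<alpha> \<Longrightarrow> weyl_length n \<alpha> g \<le> weyl_length n \<alpha> (longest_element n \<alpha>)"
    unfolding longest_element_def using arg_max_nat_lemma[OF id bound] by auto
qed

lemma reduced_if_in_reduced_words: "w \<in> reduced_words n \<alpha> \<Longrightarrow> reduced n \<alpha> w"
  unfolding reduced_words_def longest_length_def by (auto simp: reduced_eq_weyl_length)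

text \<open>Otherwise appending i to a reduced word of the longest element gives an element with one
  inversion more, hence of greater length.\<close>

lemma longest_element_negative:
  assumes "i \<in> {1..n}"
  shows "positive (- longest_element n \<alpha> (\<alpha> i))"
proof (rule ccontr)
  assume not_neg: "\<not> ?thesis"
  obtain w where w: "reduced n \<alpha> w" "word_act \<alpha> w = longest_element n \<alpha>"
    using reduced_word_exists[OF longest_element(1)] .
  have "positive (word_act \<alpha> w (\<alpha> i))"
    using not_neg w root_cases word_act_root simple_root[OF assms] reduced_in_words by metis
  then have "card (inversions (word_act \<alpha> (w @ [i]))) = Suc (card (inversions (word_act \<alpha> w)))"
    by (rule card_inversions_snoc[OF reduced_in_words[OF w(1)] assms])
  moreover have "word_act \<alpha> (w @ [i]) \<in> weyl_group n \<alpha>" "word_act \<alpha> w \<in> weyl_group n \<alpha>"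
    using reduced_in_words[OF w(1)] assms by (auto simp: weyl_group_def)
  ultimately show False
    using longest_element(2)[of "word_act \<alpha> (w @ [i])"] w(2)
    by (simp add: weyl_length_eq_card_inversions)
qed

section \<open>Height, and the action of the longest element on simple roots\<close>

definition height :: "'a \<Rightarrow> real" where
  "height b = (\<Sum>i\<in>{1..n}. coord i b)"

lemma linear_height: "linear height"
  unfolding height_def[abs_def] by (intro linear_compose_sum) (simp add: coord(1))

lemma height_simple_root [simp]: "i \<in> {1..n} \<Longrightarrow> height (\<alpha> i) = 1"
  by (simp add: height_def coord(2))

lemma height_sum: "height (\<Sum>i\<in>{1..n}. c i *\<^sub>R \<alpha> i) = (\<Sum>i\<in>{1..n}. c i)"
  unfolding height_def by (rule sum.cong[OF HOL.refl]) (rule coord_sum)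

lemma height_positive: "positive b \<Longrightarrow> height b \<ge> 1"
proof -
  assume b: "positive b"
  then obtain m :: "nat \<Rightarrow> nat" where m: "b = (\<Sum>i\<in>{1..n}. real (m i) *\<^sub>R \<alpha> i)"
    by (rule positive_nat_coeffs)
  have "(\<Sum>i\<in>{1..n}. m i) \<noteq> 0"
  proof
    assume "(\<Sum>i\<in>{1..n}. m i) = 0"
    then have "b = 0"
      unfolding m by (intro sum.neutral) auto
    then show False
      using b root_nonzero by (auto simp: positive_def)
  qed
  then have "1 \<le> (\<Sum>i\<in>{1..n}. m i)"
    by linarith
  then have "1 \<le> real (\<Sum>i\<in>{1..n}. m i)"
    by linarith
  then show "height b \<ge> 1"
    unfolding m height_sum by simp
qed

lemma longest_element_positive:
  assumes "positive b"
  shows "positive (- longest_element n \<alpha> b)"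
proof -
  obtain w where w: "reduced n \<alpha> w" "word_act \<alpha> w = longest_element n \<alpha>"
    using reduced_word_exists[OF longest_element(1)] .
  have lin: "linear (longest_element n \<alpha>)"
    using linear_word_act w(2) by metis
  have "longest_element n \<alpha> b = longest_element n \<alpha> (\<Sum>i\<in>{1..n}. coord i b *\<^sub>R \<alpha> i)"
    using assms root_expansion by (metis positive_def)
  also have "\<dots> = (\<Sum>i\<in>{1..n}. coord i b *\<^sub>R longest_element n \<alpha> (\<alpha> i))"
    by (simp add: linear_sum[OF lin] linear_cmul[OF lin])
  finally have "coord j (- longest_element n \<alpha> b) =
      (\<Sum>i\<in>{1..n}. coord i b * coord j (- longest_element n \<alpha> (\<alpha> i)))" for j
    by (simp add: coord_uminus linear_sum[OF coord(1)] linear_cmul[OF coord(1)] sum_negf)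
  then have "coord j (- longest_element n \<alpha> b) \<ge> 0" if "j \<in> {1..n}" for j
    using that assms longest_element_negative unfolding positive_def
    by (auto intro!: sum_nonneg mult_nonneg_nonneg)
  moreover have "- longest_element n \<alpha> b \<in> \<Phi>"
    using assms uminus_root word_act_root[OF reduced_in_words[OF w(1)]] w(2) by (simp add: positive_def)
  ultimately show ?thesis
    by (simp add: positive_def)
qed

lemma longest_element_orthogonal: "orthogonal_transformation (longest_element n \<alpha>)"
  using longest_element(1) orthogonal_transformation_word_act unfolding weyl_group_def by fastforce

text \<open>The negative of the longest element is injective on the finite set of positive roots and
  maps it into itself, so it permutes that set. Comparing heights shows that it sends simple roots
  to simple roots.\<close>

lemma longest_element_simple_root:
  assumes i: "i \<in> {1..n}"
  obtains j where "j \<in> {1..n}" "longest_element n \<alpha> (\<alpha> i) = - \<alpha> j"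
proof -
  let ?P = "\<lambda>x. - longest_element n \<alpha> x"
  have lin: "linear ?P" and inj: "inj ?P"
    using orthogonal_transformation_linear[OF longest_element_orthogonal]
      orthogonal_transformation_inj[OF longest_element_orthogonal]
    by (auto intro: linear_compose_neg simp: inj_def)
  have "finite {b. positive b}"
    by (rule finite_subset[OF _ finite_roots]) (auto simp: positive_def)
  moreover have "?P ` {b. positive b} \<subseteq> {b. positive b}"
    using longest_element_positive by blast
  ultimately have "?P ` {b. positive b} = {b. positive b}"
    using inj by (intro endo_inj_surj inj_on_subset[OF inj]) auto
  then have "\<forall>j\<in>{1..n}. \<exists>c. positive c \<and> ?P c = \<alpha> j"
    using positive_simple_root by (metis (mono_tags, lifting) imageE mem_Collect_eq)
  then obtain c where c: "\<And>j. j \<in> {1..n} \<Longrightarrow> positive (c j) \<and> ?P (c j) = \<alpha> j"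
    by metis
  obtain m :: "nat \<Rightarrow> nat" where m: "?P (\<alpha> i) = (\<Sum>j\<in>{1..n}. real (m j) *\<^sub>R \<alpha> j)"
    using positive_nat_coeffs longest_element_negative[OF i] by blast
  also have "\<dots> = (\<Sum>j\<in>{1..n}. real (m j) *\<^sub>R ?P (c j))"
    using c by simp
  also have "\<dots> = ?P (\<Sum>j\<in>{1..n}. real (m j) *\<^sub>R c j)"
    by (simp only: linear_sum[OF lin] linear_cmul[OF lin])
  \<comment> \<open>\<open>\<alpha> i\<close> has height 1 and each \<open>c j\<close> has height at
    least 1, so at most one coefficient is nonzero, and it equals 1.\<close>
  finally have "\<alpha> i = (\<Sum>j\<in>{1..n}. real (m j) *\<^sub>R c j)"
    by (rule injD[OF inj])
  then have "1 = (\<Sum>j\<in>{1..n}. real (m j) * height (c j))"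
    using height_simple_root[OF i] by (simp add: linear_sum[OF linear_height] linear_cmul[OF linear_height])
  also have "\<dots> \<ge> (\<Sum>j\<in>{1..n}. real (m j) * 1)"
    using c height_positive by (intro sum_mono mult_left_mono) auto
  finally have "real (\<Sum>j\<in>{1..n}. m j) \<le> 1"
    by simp
  moreover have "real (\<Sum>j\<in>{1..n}. m j) \<ge> 1"
    using height_positive[OF longest_element_negative[OF i]] unfolding m height_sum by simp
  ultimately have "(\<Sum>j\<in>{1..n}. m j) = 1"
    by linarith
  then obtain j where j: "j \<in> {1..n}" "m j = 1" "\<And>k. k \<in> {1..n} \<Longrightarrow> k \<noteq> j \<Longrightarrow> m k = 0"
    using sum_eq_1_iff[of "{1..n}" m] by auto
  have "?P (\<alpha> i) = (\<Sum>k\<in>{1..n}. if k = j then \<alpha> j else 0)"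
    unfolding m using j by (intro sum.cong) auto
  then have "?P (\<alpha> i) = \<alpha> j"
    using j(1) by simp
  then show ?thesis
    using that j(1) by (metis minus_minus)
qed

end

section \<open>The longest element and the roots along its reduced words\<close>

context simple_root_system
begin

text \<open>The difference is orthogonal to all roots, which span the space, hence to itself. This
  yields uniqueness of the fundamental weights.\<close>

lemma eq_if_inner_simple_roots_eq:
  assumes "\<And>j. j \<in> {1..n} \<Longrightarrow> \<alpha> j \<bullet> v = \<alpha> j \<bullet> v'"
  shows "v = v'"
proof -
  have "b \<bullet> (v - v') = 0" if "b \<in> \<Phi>" for b
  proof -
    have "(\<Sum>i\<in>{1..n}. coord i b *\<^sub>R \<alpha> i) \<bullet> (v - v') = 0"
      using assms by (simp add: inner_sum_left inner_diff_right)
    then show ?thesis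
      using root_expansion[OF that] by metis
  qed
  moreover have "v - v' \<in> span \<Phi>"
    by (simp add: span_roots)
  ultimately have "(v - v') \<bullet> (v - v') = 0"
    by (intro span_induct[of "v - v'" \<Phi> "\<lambda>x. x \<bullet> (v - v') = 0"])
      (auto simp: subspace_def inner_add_left)
  then show ?thesis
    by simp
qed

lemma inner_fund_weight:
  assumes i: "i \<in> {1..n}" and j: "j \<in> {1..n}"
  shows "\<alpha> j \<bullet> fund_weight n \<alpha> i = (if j = i then \<alpha> j \<bullet> \<alpha> j / 2 else 0)"
proof -
  let ?P = "\<lambda>v. \<forall>j\<in>{1..n}. 2 * (\<alpha> j \<bullet> v) / (\<alpha> j \<bullet> \<alpha> j) = (if j = i then 1 else 0)"
  have P: "?P v \<longleftrightarrow> (\<forall>j\<in>{1..n}. \<alpha> j \<bullet> v = (if j = i then \<alpha> j \<bullet> \<alpha> j / 2 else 0))" for v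
    using simple_root_nonzero by (intro ball_cong) (auto simp: field_simps)
  \<comment> \<open>The adjoint at 1 is the vector representing \<open>coord i\<close> by the inner
    product; scaling by half the squared length gives the fundamental weight.\<close>
  have "?P (((\<alpha> i \<bullet> \<alpha> i) / 2) *\<^sub>R adjoint (coord i) 1)"
    unfolding P by (simp add: adjoint_works[OF coord(1)] coord(2))
  then have "\<exists>!v. ?P v"
  proof (rule ex1I)
    fix v
    assume "?P v"
    with \<open>?P (((\<alpha> i \<bullet> \<alpha> i) / 2) *\<^sub>R adjoint (coord i) 1)\<close>
    show "v = ((\<alpha> i \<bullet> \<alpha> i) / 2) *\<^sub>R adjoint (coord i) 1"
      unfolding P by (intro eq_if_inner_simple_roots_eq) metis
  qed
  then have "?P (fund_weight n \<alpha> i)"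
    unfolding fund_weight_def by (rule theI')
  then show ?thesis
    unfolding P using j by blast
qed

lemma fund_weight_inj:
  assumes "i \<in> {1..n}" "j \<in> {1..n}" "fund_weight n \<alpha> i = fund_weight n \<alpha> j"
  shows "i = j"
  using inner_fund_weight[OF assms(1) assms(1)] inner_fund_weight[OF assms(2) assms(1)]
    simple_root_nonzero[OF assms(1)] assms(3) by (auto split: if_splits)

text \<open>\<open>star\<close> is defined through weights but is needed for roots. The permutation
  \<tau> of simple roots induced by the longest element is transferred to weights by orthogonality,
  pairing with each simple root.\<close>

lemma longest_element_star:
  assumes i: "i \<in> {1..n}"
  shows "star n \<alpha> i \<in> {1..n}" "longest_element n \<alpha> (\<alpha> i) = - \<alpha> (star n \<alpha> i)"
proof -
  let ?w = "longest_element n \<alpha>"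
  have inner: "?w x \<bullet> ?w y = x \<bullet> y" for x y
    using longest_element_orthogonal by (simp add: orthogonal_transformation_def)
  have "\<forall>k\<in>{1..n}. \<exists>j. j \<in> {1..n} \<and> ?w (\<alpha> k) = - \<alpha> j"
    using longest_element_simple_root by metis
  then obtain \<tau> where \<tau>: "\<And>k. k \<in> {1..n} \<Longrightarrow> \<tau> k \<in> {1..n}"
    "\<And>k. k \<in> {1..n} \<Longrightarrow> ?w (\<alpha> k) = - \<alpha> (\<tau> k)"
    by metis
  have \<tau>_inj: "inj_on \<tau> {1..n}"
  proof (rule inj_onI)
    fix j k assume jk: "j \<in> {1..n}" "k \<in> {1..n}" "\<tau> j = \<tau> k"
    then have "?w (\<alpha> j) = ?w (\<alpha> k)"
      using \<tau>(2) by metis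
    then have "\<alpha> j = \<alpha> k"
      by (rule injD[OF orthogonal_transformation_inj[OF longest_element_orthogonal]])
    then show "j = k"
      using simple_root_inj jk by blast
  qed
  then have \<tau>_surj: "\<tau> ` {1..n} = {1..n}"
    using \<tau>(1) by (intro endo_inj_surj) auto
  have "?w (fund_weight n \<alpha> i) = - fund_weight n \<alpha> (\<tau> i)"
  proof (rule eq_if_inner_simple_roots_eq)
    fix j assume "j \<in> {1..n}"
    then obtain k where k: "k \<in> {1..n}" "j = \<tau> k"
      using \<tau>_surj by blast
    have "\<alpha> j \<bullet> ?w (fund_weight n \<alpha> i) = - (\<alpha> k \<bullet> fund_weight n \<alpha> i)"
      using inner[of "\<alpha> k"] \<tau>(2)[OF k(1)] k(2) by (metis inner_minus_left minus_minus)
    \<comment> \<open>The pairing with a weight involves half the squared length of the root, so the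
      two lengths must agree.\<close>
    moreover have "\<alpha> (\<tau> k) \<bullet> \<alpha> (\<tau> k) = \<alpha> k \<bullet> \<alpha> k"
      using inner[of "\<alpha> k" "\<alpha> k"] \<tau>(2)[OF k(1)] by simp
    moreover have "\<tau> k = \<tau> i \<longleftrightarrow> k = i"
      using inj_onD[OF \<tau>_inj] k(1) i by blast
    ultimately show "\<alpha> j \<bullet> ?w (fund_weight n \<alpha> i) = \<alpha> j \<bullet> - fund_weight n \<alpha> (\<tau> i)"
      using inner_fund_weight[OF i k(1)] inner_fund_weight[OF \<tau>(1)[OF i] \<tau>(1)[OF k(1)]] k(2)
      by (cases "k = i") simp_all
  qed
  then have "star n \<alpha> i = \<tau> i"
    unfolding star_def using \<tau>(1)[OF i] fund_weight_inj
    by (intro the_equality) auto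
  then show "star n \<alpha> i \<in> {1..n}" "?w (\<alpha> i) = - \<alpha> (star n \<alpha> i)"
    using \<tau> i by auto
qed

lemma star_inj:
  assumes "i \<in> {1..n}" "j \<in> {1..n}" "star n \<alpha> i = star n \<alpha> j"
  shows "i = j"
proof -
  have "longest_element n \<alpha> (\<alpha> i) = longest_element n \<alpha> (\<alpha> j)"
    using longest_element_star assms by metis
  then have "\<alpha> i = \<alpha> j"
    by (rule injD[OF orthogonal_transformation_inj[OF longest_element_orthogonal]])
  then show ?thesis
    using simple_root_inj assms by blast
qed

text \<open>Ensures that \<open>last w\<close> and \<open>length w - 1\<close> have their intended
  meaning.\<close>

lemma reduced_words_nonempty:
  assumes "w \<in> reduced_words n \<alpha>" "i \<in> {1..n}"
  shows "w \<noteq> []"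
proof
  assume "w = []"
  then have "longest_element n \<alpha> = id"
    using assms by (simp add: reduced_words_def)
  then show False
    using longest_element_negative[OF assms(2)] positive_simple_root[OF assms(2)]
      positive_not_negative by auto
qed

text \<open>Writing w as a word u followed by i, the longest element sends \<open>\<alpha> i\<close>
  to minus the last root of w, and also to minus the simple root of index
  \<open>star n \<alpha> i\<close>.\<close>

lemma word_root_last:
  assumes w: "w \<in> reduced_words n \<alpha>" and i: "i \<in> {1..n}" "last w = i"
  shows "word_root \<alpha> w (length w - 1) = \<alpha> (star n \<alpha> i)"
proof -
  have w_eq: "w = butlast w @ [i]"
    using reduced_words_nonempty[OF w i(1)] i(2) by (metis append_butlast_last_id)
  have "word_act \<alpha> w (\<alpha> i) = - \<alpha> (star n \<alpha> i)"
    using w longest_element_star[OF i(1)] by (simp add: reduced_words_def)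
  moreover have "word_act \<alpha> w (\<alpha> i) = - word_act \<alpha> (butlast w) (\<alpha> i)"
    by (subst w_eq) (simp add: word_act_append word_act_Cons simple_reflection_self[OF i(1)] word_act_uminus)
  moreover have "word_root \<alpha> w (length w - 1) = word_act \<alpha> (butlast w) (\<alpha> i)"
    using word_root_append[of \<alpha> "butlast w" i "[]"] w_eq by (metis length_butlast)
  ultimately show ?thesis
    by simp
qed

lemma word_root_positive:
  assumes w: "reduced n \<alpha> w" and k: "k < length w"
  shows "positive (word_root \<alpha> w k)"
proof -
  have "take (Suc k) w = take k w @ [w ! k]"
    using k by (rule take_Suc_conv_app_nth)
  then show ?thesis
    unfolding word_root_def using reduced_snoc_positive reduced_prefix w
    by (metis append_take_drop_id)
qed

lemma word_root_eq_iff: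
  "reduced n \<alpha> w \<Longrightarrow> j < length w \<Longrightarrow> k < length w \<Longrightarrow>
    word_root \<alpha> w j = word_root \<alpha> w k \<longleftrightarrow> j = k"
  using word_root_inj simple_root_nonzero by metis

lemma inj_on_word_root: "reduced n \<alpha> w \<Longrightarrow> inj_on (word_root \<alpha> w) {..<length w}"
  by (auto simp: inj_on_def word_root_eq_iff)

end

section \<open>Effect of the moves on the roots along a word\<close>

lemma word_root_exchange:
  assumes "word_act \<alpha> x = word_act \<alpha> y" "length x = length y"
    and "k < length u \<or> length u + length x \<le> k"
  shows "word_root \<alpha> (u @ x @ v) k = word_root \<alpha> (u @ y @ v) k"
  using assms by (auto simp: word_root_def word_act_append nth_append)

lemma word_act_commute:
  assumes "\<alpha> a \<bullet> \<alpha> b = 0"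
  shows "word_act \<alpha> [a, b] = word_act \<alpha> [b, a]"
proof -
  have "reflection (\<alpha> a) (\<alpha> b) = \<alpha> b"
    using assms by (simp add: reflection_def)
  then have "reflection (\<alpha> b) (reflection (\<alpha> a) x) = reflection (\<alpha> a) (reflection (\<alpha> b) x)" for x
    using reflection_conjugate[OF orthogonal_transformation_reflection, of "\<alpha> a" "\<alpha> b" x] by simp
  then show ?thesis
    by (simp add: word_act_Cons fun_eq_iff)
qed

lemma reflection_braid:
  assumes "a \<noteq> 0" "a \<bullet> a = b \<bullet> b" "2 * (a \<bullet> b) = - (a \<bullet> a)"
  shows "reflection a b = a + b" "reflection a (reflection b a) = b"
proof -
  have "reflection a b = b - (- (a \<bullet> a) / (a \<bullet> a)) *\<^sub>R a"
    using assms(3) by (simp only: reflection_def)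
  then show *: "reflection a b = a + b"
    using assms(1) by simp
  have "reflection b a = a + b"
    using assms by (simp add: reflection_def inner_commute)
  then have "reflection a (reflection b a) = reflection a a + reflection a b"
    by (simp add: linear_add[OF linear_reflection])
  then show "reflection a (reflection b a) = b"
    using * assms(1) by (simp add: reflection_self)
qed

lemma word_act_braid:
  assumes "\<alpha> a \<noteq> 0" "\<alpha> a \<bullet> \<alpha> a = \<alpha> b \<bullet> \<alpha> b" "2 * (\<alpha> a \<bullet> \<alpha> b) = - (\<alpha> a \<bullet> \<alpha> a)"
  shows "word_act \<alpha> [a, b, a] = word_act \<alpha> [b, a, b]"
proof -
  \<comment> \<open>The product of the reflections for a and b sends \<open>\<alpha> a\<close> to
    \<open>\<alpha> b\<close>; conjugating the reflection in \<open>\<alpha> a\<close> by it gives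
    the braid relation.\<close>
  have "reflection (\<alpha> b) (reflection (\<alpha> a) (reflection (\<alpha> b) x)) =
      reflection (\<alpha> a) (reflection (\<alpha> b) (reflection (\<alpha> a) x))" for x
    using reflection_conjugate[OF orthogonal_transformation_word_act, of \<alpha> "[a, b]" "\<alpha> a" x]
      reflection_braid(2)[OF assms]
    by (simp add: word_act_Cons)
  then show ?thesis
    by (simp add: word_act_Cons fun_eq_iff)
qed

lemma two_term_move_roots:
  assumes move: "two_term_move \<alpha> l w w'" and nz: "\<forall>i\<in>set w. \<alpha> i \<noteq> 0"
  shows "length w' = length w" "set w' = set w" "word_act \<alpha> w' = word_act \<alpha> w" "l + 1 < length w"
    "word_root \<alpha> w l \<bullet> word_root \<alpha> w (l + 1) = 0"
    "word_root \<alpha> w (Transposition.transpose l (l + 1) k) = word_root \<alpha> w' k"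
proof -
  obtain u a b v where l: "length u = l" and w: "w = u @ [a, b] @ v" and w': "w' = u @ [b, a] @ v"
    and c: "cartan \<alpha> a b = 0"
    using move unfolding two_term_move_def by blast
  have "\<alpha> a \<noteq> 0"
    using nz w by simp
  with c have orth: "\<alpha> a \<bullet> \<alpha> b = 0"
    by (simp add: cartan_def)
  then have ab: "reflection (\<alpha> a) (\<alpha> b) = \<alpha> b" "reflection (\<alpha> b) (\<alpha> a) = \<alpha> a"
    by (simp_all add: reflection_def inner_commute)
  note act = word_act_commute[OF orth]
  show "length w' = length w" "set w' = set w" "l + 1 < length w"
    using w w' l by auto
  show "word_act \<alpha> w' = word_act \<alpha> w"
    unfolding w w' word_act_append act ..
  have roots: "word_root \<alpha> w l = word_act \<alpha> u (\<alpha> a)" "word_root \<alpha> w (l + 1) = word_act \<alpha> u (\<alpha> b)"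
    "word_root \<alpha> w' l = word_act \<alpha> u (\<alpha> b)" "word_root \<alpha> w' (l + 1) = word_act \<alpha> u (\<alpha> a)"
    unfolding w w' l[symmetric]
    using word_root_append[of \<alpha> "u @ [a]" b v] word_root_append[of \<alpha> "u @ [b]" a v]
    by (simp_all add: word_act_append word_act_Cons ab)
  show "word_root \<alpha> w l \<bullet> word_root \<alpha> w (l + 1) = 0"
    unfolding roots by (simp add: orth)
  show "word_root \<alpha> w (Transposition.transpose l (l + 1) k) = word_root \<alpha> w' k"
  proof (cases "k = l \<or> k = l + 1")
    case True
    then show ?thesis
      using roots by auto
  next
    case False
    then have "k < length u \<or> length u + length [a, b] \<le> k"
      using l by auto
    then show ?thesis
      using False word_root_exchange[OF act, of k u v] unfolding w w'
      by (simp add: Transposition.transpose_def)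
  qed
qed

text \<open>The three affected roots are the images under the prefix of \<open>\<alpha> a\<close>,
  \<open>\<alpha> a + \<alpha> b\<close> and \<open>\<alpha> b\<close>; the move reverses their
  order and fixes all later roots.\<close>

lemma three_term_move_roots:
  assumes move: "three_term_move \<alpha> l w w'" and nz: "\<forall>i\<in>set w. \<alpha> i \<noteq> 0"
    and laced: "\<forall>i\<in>set w. \<forall>j\<in>set w. i \<noteq> j \<longrightarrow> cartan \<alpha> i j \<in> {0, -1}"
  shows "length w' = length w" "set w' = set w" "word_act \<alpha> w' = word_act \<alpha> w" "l + 2 < length w"
    "word_root \<alpha> w (l + 1) = word_root \<alpha> w l + word_root \<alpha> w (l + 2)"
    "word_root \<alpha> w l \<bullet> word_root \<alpha> w (l + 1) \<noteq> 0"
    "word_root \<alpha> w l \<bullet> word_root \<alpha> w (l + 2) \<noteq> 0"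
    "word_root \<alpha> w' (l + 2) = word_root \<alpha> w l"
    "k > l + 2 \<Longrightarrow> word_root \<alpha> w' k = word_root \<alpha> w k"
proof -
  obtain u a b v where l: "length u = l" and w: "w = u @ [a, b, a] @ v" and w': "w' = u @ [b, a, b] @ v"
    and c: "cartan \<alpha> b a = -1"
    using move unfolding three_term_move_def by blast
  have in_w: "a \<in> set w" "b \<in> set w"
    using w by auto
  then have ne: "\<alpha> a \<noteq> 0" "\<alpha> b \<noteq> 0"
    using nz by auto
  have "a \<noteq> b"
    using c ne by (auto simp: cartan_def)
  \<comment> \<open>The move gives only one Cartan integer. It makes the inner product nonzero, so
    the other one is -1 too and both roots have equal length.\<close>
  then have "cartan \<alpha> a b \<in> {0, -1}"
    using laced in_w by blast
  moreover have ba: "2 * (\<alpha> a \<bullet> \<alpha> b) = - (\<alpha> b \<bullet> \<alpha> b)"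
    using c ne by (simp add: cartan_def field_simps inner_commute)
  ultimately have ab: "2 * (\<alpha> a \<bullet> \<alpha> b) = - (\<alpha> a \<bullet> \<alpha> a)"
    using ne by (auto simp: cartan_def field_simps)
  have norm: "\<alpha> a \<bullet> \<alpha> a = \<alpha> b \<bullet> \<alpha> b"
    using ab ba by simp
  note braid = reflection_braid[OF ne(1) norm ab]
  have ab': "2 * (\<alpha> b \<bullet> \<alpha> a) = - (\<alpha> b \<bullet> \<alpha> b)"
    using ba by (simp add: inner_commute)
  note braid' = reflection_braid[OF ne(2) norm[symmetric] ab']
  note act = word_act_braid[OF ne(1) norm ab]
  show "length w' = length w" "set w' = set w" "l + 2 < length w"
    using w w' l by auto
  show "word_act \<alpha> w' = word_act \<alpha> w"
    unfolding w w' word_act_append act ..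
  have roots: "word_root \<alpha> w l = word_act \<alpha> u (\<alpha> a)" "word_root \<alpha> w (l + 1) = word_act \<alpha> u (\<alpha> a + \<alpha> b)"
    "word_root \<alpha> w (l + 2) = word_act \<alpha> u (\<alpha> b)" "word_root \<alpha> w' (l + 2) = word_act \<alpha> u (\<alpha> a)"
    unfolding w w' l[symmetric]
    using word_root_append[of \<alpha> "u @ [a]" b "a # v"] word_root_append[of \<alpha> "u @ [a, b]" a v]
      word_root_append[of \<alpha> "u @ [b, a]" b v]
    by (simp_all add: word_act_append word_act_Cons braid braid' reflection_self ne
        linear_add[OF linear_reflection])
  show "word_root \<alpha> w (l + 1) = word_root \<alpha> w l + word_root \<alpha> w (l + 2)"
    unfolding roots by (rule linear_add[OF linear_word_act])
  have "\<alpha> a \<bullet> \<alpha> a > 0"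
    using ne by simp
  then have "\<alpha> a \<bullet> (\<alpha> a + \<alpha> b) \<noteq> 0" "\<alpha> a \<bullet> \<alpha> b \<noteq> 0"
    using ab unfolding inner_add_right by linarith+
  then show "word_root \<alpha> w l \<bullet> word_root \<alpha> w (l + 1) \<noteq> 0"
    "word_root \<alpha> w l \<bullet> word_root \<alpha> w (l + 2) \<noteq> 0"
    unfolding roots word_act_inner by blast+
  show "word_root \<alpha> w' (l + 2) = word_root \<alpha> w l"
    unfolding roots ..
  show "k > l + 2 \<Longrightarrow> word_root \<alpha> w' k = word_root \<alpha> w k"
    using word_root_exchange[OF act, of k u v] l unfolding w w' by simp
qed

text \<open>The invariant of the backward induction, with \<beta> fixed throughout.
  Non-orthogonality is recorded because it keeps a and b to the right of p under 2-term
  moves.\<close>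

definition root_pairs ::
    "(nat \<Rightarrow> 'a::real_inner) \<Rightarrow> nat list \<Rightarrow> 'a \<Rightarrow> nat \<Rightarrow> (nat \<times> nat) set \<Rightarrow> bool" where
  "root_pairs \<alpha> w \<beta> p T \<longleftrightarrow>
     finite T \<and> p < length w \<and> word_root \<alpha> w p = \<beta> \<and>
     (\<forall>a b. (a, b) \<in> T \<longrightarrow> p < a \<and> a < length w \<and> p < b \<and> b < length w \<and>
        word_root \<alpha> w a = \<beta> + word_root \<alpha> w b \<and>
        \<beta> \<bullet> word_root \<alpha> w a \<noteq> 0 \<and> \<beta> \<bullet> word_root \<alpha> w b \<noteq> 0)"

lemma root_pairsI:
  assumes "finite T" "p < length w" "word_root \<alpha> w p = \<beta>"
    and "\<And>a b. (a, b) \<in> T \<Longrightarrow> p < a \<and> a < length w \<and> p < b \<and> b < length w \<and>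
      word_root \<alpha> w a = \<beta> + word_root \<alpha> w b \<and>
      \<beta> \<bullet> word_root \<alpha> w a \<noteq> 0 \<and> \<beta> \<bullet> word_root \<alpha> w b \<noteq> 0"
  shows "root_pairs \<alpha> w \<beta> p T"
  unfolding root_pairs_def
  by (rule conjI[OF assms(1) conjI[OF assms(2) conjI[OF assms(3)]]], intro allI impI, rule assms(4))

lemma root_pairsD:
  assumes "root_pairs \<alpha> w \<beta> p T"
  shows "finite T" "p < length w" "word_root \<alpha> w p = \<beta>"
  using assms by (simp_all only: root_pairs_def)

lemma root_pairs_memD:
  assumes "root_pairs \<alpha> w \<beta> p T" "(a, b) \<in> T"
  shows "p < a" "a < length w" "p < b" "b < length w"
    "word_root \<alpha> w a = \<beta> + word_root \<alpha> w b"
    "\<beta> \<bullet> word_root \<alpha> w a \<noteq> 0" "\<beta> \<bullet> word_root \<alpha> w b \<noteq> 0"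
  using assms(1)[unfolded root_pairs_def, THEN conjunct2, THEN conjunct2, THEN conjunct2,
      rule_format, OF assms(2)]
  by - (elim conjE, assumption)+

lemma root_pairs_two_term:
  assumes move: "two_term_move \<alpha> l w w'" and nz: "\<forall>i\<in>set w. \<alpha> i \<noteq> 0"
    and pairs: "root_pairs \<alpha> w' \<beta> p T"
  defines "s \<equiv> Transposition.transpose l (l + 1)"
  shows "root_pairs \<alpha> w \<beta> (s p) (map_prod s s ` T)"
proof -
  note roots = two_term_move_roots[OF move nz, folded s_def]
  have less: "s k < length w" if "k < length w'" for k
    using that roots(1,4) by (auto simp: s_def Transposition.transpose_def)
  \<comment> \<open>The transposition reverses p < k only for p = l and k = l + 1, where the two
    roots would be orthogonal.\<close>
  have order: "s p < s k" if "p < k" "\<beta> \<bullet> word_root \<alpha> w' k \<noteq> 0" for k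
  proof -
    have False if "p = l" "k = l + 1"
    proof -
      have "\<beta> = word_root \<alpha> w (l + 1)" "word_root \<alpha> w' k = word_root \<alpha> w l"
        using root_pairsD(3)[OF pairs] roots(6)[of l] roots(6)[of "l + 1"] that by (auto simp: s_def)
      then show False
        using \<open>\<beta> \<bullet> word_root \<alpha> w' k \<noteq> 0\<close> roots(5) by (simp add: inner_commute)
    qed
    with \<open>p < k\<close> show ?thesis
      by (auto simp: s_def Transposition.transpose_def)
  qed
  note T = root_pairs_memD[OF pairs]
  have s_T: "s p < s a \<and> s a < length w \<and> s p < s b \<and> s b < length w \<and>
      word_root \<alpha> w (s a) = \<beta> + word_root \<alpha> w (s b) \<and>
      \<beta> \<bullet> word_root \<alpha> w (s a) \<noteq> 0 \<and> \<beta> \<bullet> word_root \<alpha> w (s b) \<noteq> 0" if "(a, b) \<in> T" for a b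
    unfolding roots(6) by (intro conjI less order T[OF that])
  have base: "finite (map_prod s s ` T)" "s p < length w" "word_root \<alpha> w (s p) = \<beta>"
    unfolding roots(6) by (intro finite_imageI less root_pairsD[OF pairs])+
  have image: "\<exists>a' b'. (a', b') \<in> T \<and> a = s a' \<and> b = s b'" if "(a, b) \<in> map_prod s s ` T" for a b
    using that by auto
  show ?thesis
  proof (rule root_pairsI[OF base])
    fix a b assume "(a, b) \<in> map_prod s s ` T"
    then obtain a' b' where "(a', b') \<in> T" "a = s a'" "b = s b'"
      using image by blast
    with s_T show "s p < a \<and> a < length w \<and> s p < b \<and> b < length w \<and>
        word_root \<alpha> w a = \<beta> + word_root \<alpha> w b \<and>
        \<beta> \<bullet> word_root \<alpha> w a \<noteq> 0 \<and> \<beta> \<bullet> word_root \<alpha> w b \<noteq> 0"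
      by metis
  qed
qed

text \<open>Along w' the root \<beta> stands at l + 2, and roots are distinct, so p = l + 2. All old
  pairs lie further right and keep their roots; the middle root of the move, being the sum of the
  outer ones, supplies the new pair.\<close>

lemma root_pairs_three_term:
  assumes move: "three_term_move \<alpha> l w w'" and nz: "\<forall>i\<in>set w. \<alpha> i \<noteq> 0"
    and laced: "\<forall>i\<in>set w. \<forall>j\<in>set w. i \<noteq> j \<longrightarrow> cartan \<alpha> i j \<in> {0, -1}"
    and pairs: "root_pairs \<alpha> w' (word_root \<alpha> w l) p T"
    and inj: "inj_on (word_root \<alpha> w') {..<length w'}"
  shows "p = l + 2" "root_pairs \<alpha> w (word_root \<alpha> w l) l (insert (l + 1, l + 2) T)"
proof -
  note roots = three_term_move_roots[OF move nz laced]
  show p: "p = l + 2"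
    using root_pairsD(2,3)[OF pairs] roots(1,4,8) by (intro inj_onD[OF inj]) auto
  show "root_pairs \<alpha> w (word_root \<alpha> w l) l (insert (l + 1, l + 2) T)"
  proof (rule root_pairsI[OF _ _ HOL.refl])
    show "finite (insert (l + 1, l + 2) T)" "l < length w"
      using root_pairsD(1)[OF pairs] roots(4) by simp_all
    fix a b assume "(a, b) \<in> insert (l + 1, l + 2) T"
    then consider "a = l + 1" "b = l + 2" | "(a, b) \<in> T"
      by blast
    then show "l < a \<and> a < length w \<and> l < b \<and> b < length w \<and>
        word_root \<alpha> w a = word_root \<alpha> w l + word_root \<alpha> w b \<and>
        word_root \<alpha> w l \<bullet> word_root \<alpha> w a \<noteq> 0 \<and> word_root \<alpha> w l \<bullet> word_root \<alpha> w b \<noteq> 0"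
    proof cases
      case 1
      have "l < l + 1" "l + 1 < length w" "l < l + 2"
        using roots(4) by simp_all
      then show ?thesis
        unfolding 1 using roots(4-7) by blast
    next
      case 2
      then have ab: "l + 2 < a" "a < length w'" "l + 2 < b" "b < length w'"
        "word_root \<alpha> w' a = word_root \<alpha> w l + word_root \<alpha> w' b"
        "word_root \<alpha> w l \<bullet> word_root \<alpha> w' a \<noteq> 0" "word_root \<alpha> w l \<bullet> word_root \<alpha> w' b \<noteq> 0"
        using root_pairs_memD[OF pairs 2] unfolding p by simp_all
      then show ?thesis
        using roots(9)[OF ab(1)] roots(9)[OF ab(3)] roots(1) by (metis add_lessD1)
    qed
  qed
qed

section \<open>Simply-braided words\<close>

locale simply_laced_root_system = simple_root_system +
  assumes simply_laced: "simply_laced n \<alpha>"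
begin

lemma reduced_word_letters:
  assumes "w \<in> reduced_words n \<alpha>"
  shows "\<forall>i\<in>set w. \<alpha> i \<noteq> 0"
    and "\<forall>i\<in>set w. \<forall>j\<in>set w. i \<noteq> j \<longrightarrow> cartan \<alpha> i j \<in> {0, -1}"
  using assms simple_root_nonzero simply_laced
  unfolding reduced_words_def words_def simply_laced_def by blast+

lemma reduced_words_iff:
  assumes "length w' = length w" "set w' = set w" "word_act \<alpha> w' = word_act \<alpha> w"
  shows "w' \<in> reduced_words n \<alpha> \<longleftrightarrow> w \<in> reduced_words n \<alpha>"
  using assms by (simp add: reduced_words_def words_def)

text \<open>The compatibility in \<open>sigma_family\<close> applies only to reduced words of the
  longest element, so every intermediate word must be one.\<close>

lemma simple_move_reduced_words:
  assumes "simple_move n \<alpha> i w w'" "w \<in> reduced_words n \<alpha>"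
  shows "w' \<in> reduced_words n \<alpha>"
  using assms(1) unfolding simple_move_def
proof (elim disjE exE conjE)
  fix l assume "two_term_move \<alpha> l w w'"
  from two_term_move_roots(1-3)[OF this reduced_word_letters(1)[OF assms(2)]] show ?thesis
    using assms(2) reduced_words_iff by metis
next
  fix l assume "three_term_move \<alpha> l w w'"
  from three_term_move_roots(1-3)[OF this reduced_word_letters[OF assms(2)]] show ?thesis
    using assms(2) reduced_words_iff by metis
qed

lemma sigma_simply_braided:
  assumes \<sigma>: "sigma_family n \<alpha> \<sigma>" and i: "i \<in> {1..n}"
    and "(simple_move n \<alpha> i)\<^sup>*\<^sup>* w w'" and last: "last w' = i"
    and "w \<in> reduced_words n \<alpha>"
  shows "\<exists>p T. root_pairs \<alpha> w (\<alpha> (star n \<alpha> i)) p T \<and> \<sigma> w i = var_sum p T"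
  using assms(3,5)
proof (induction rule: converse_rtranclp_induct)
  \<comment> \<open>The word ends in i: its last root is the required simple root, and there are no
    ratios yet.\<close>
  case base
  have "root_pairs \<alpha> w' (\<alpha> (star n \<alpha> i)) (length w' - 1) {}"
    using word_root_last[OF base i last] reduced_words_nonempty[OF base i]
    by (simp add: root_pairs_def)
  moreover have "\<sigma> w' i = var_sum (length w' - 1) {}"
    using \<sigma> base i last unfolding sigma_family_def var_sum_def sum.empty add_0_right by blast
  ultimately show ?case
    by blast
next
  case (step w v)
  have v: "v \<in> reduced_words n \<alpha>"
    using simple_move_reduced_words[OF step.hyps(1) step.prems] .
  obtain p T where pairs: "root_pairs \<alpha> v (\<alpha> (star n \<alpha> i)) p T" and \<sigma>_v: "\<sigma> v i = var_sum p T"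
    using step.IH[OF v] by blast
  have \<sigma>_w: "\<sigma> w i = subst y (var_sum p T)" if "transition \<alpha> w v y" for y
    using \<sigma> v step.prems i that \<sigma>_v unfolding sigma_family_def by metis
  have finite: "finite T"
    by (rule root_pairsD(1)[OF pairs])
  from step.hyps(1) show ?case
    unfolding simple_move_def
  proof (elim disjE exE conjE)
    fix l assume move: "two_term_move \<alpha> l w v"
    show ?case
      using root_pairs_two_term[OF move reduced_word_letters(1)[OF step.prems] pairs]
        \<sigma>_w[OF transition_two_term[OF move]] subst_two_term_var_sum[OF finite] by metis
  next
    fix l assume move: "three_term_move \<alpha> l w v" and l: "word_root \<alpha> w l = \<alpha> (star n \<alpha> i)"
    note three = root_pairs_three_term[OF move reduced_word_letters[OF step.prems] pairs[folded l]
        inj_on_word_root[OF reduced_if_in_reduced_words[OF v]]]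
    note p = three(1)
    have "a > l + 2 \<and> b > l + 2" if "(a, b) \<in> T" for a b
      using root_pairs_memD(1,3)[OF pairs that] unfolding p by blast
    then have "subst (three_term_map l) (var_sum p T) = var_sum l (insert (l + 1, l + 2) T)"
      unfolding p by (rule subst_three_term_var_sum[OF finite])
    then show ?case
      using three(2) l \<sigma>_w[OF transition_three_term[OF move]] by metis
  qed
qed

text \<open>
  \<open>A\<close> and \<open>B\<close> are the vectors for which the inequality of the monomial \<open>u\<close> reads \<open>t B \<ge> t A\<close>;
  the monomial \<open>x\<^sub>p\<close> counts as an edge from 0.
\<close>

definition edge :: "nat list \<Rightarrow> nat \<Rightarrow> (nat \<times> nat) set \<Rightarrow> exponents \<Rightarrow> 'a \<Rightarrow> 'a \<Rightarrow> bool" where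
  "edge w p T u A B \<longleftrightarrow>
     u = Poly_Mapping.single p 1 \<and> A = 0 \<and> B = word_root \<alpha> w p \<or>
     (\<exists>(a, b)\<in>T. u = ratio a b \<and> A = word_root \<alpha> w b \<and> B = word_root \<alpha> w a)"

lemma edge_exists:
  assumes "u \<in> monomials (var_sum p T)"
  shows "\<exists>A B. edge w p T u A B"
proof -
  consider "u = Poly_Mapping.single p 1" | a b where "(a, b) \<in> T" "u = ratio a b"
    using subsetD[OF monomials_var_sum(2) assms] by auto
  then show ?thesis
    unfolding edge_def by cases blast+
qed

context
  fixes w \<beta> p T u A B
  assumes w: "reduced n \<alpha> w" and pairs: "root_pairs \<alpha> w \<beta> p T" and \<beta>: "\<beta> \<noteq> 0"
    and edge: "edge w p T u A B"
begin

lemma edge_diff: "B = A + \<beta>"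
  using edge root_pairsD(3)[OF pairs] root_pairs_memD(5)[OF pairs] unfolding edge_def
  by (auto simp: add.commute)

lemma edge_positive: "A = 0 \<or> positive A" "positive B"
  using edge root_pairsD(2)[OF pairs] root_pairs_memD(2,4)[OF pairs] word_root_positive[OF w]
  unfolding edge_def by blast+

text \<open>The inequalities are tested only at points whose k-th coordinate is the value of t at
  the k-th root. With \<open>t 0 = 0\<close> the form of the single variable becomes a difference as
  well.\<close>

lemma linear_form_edge:
  assumes "t 0 = 0"
  shows "linear_form u (\<lambda>k. t (word_root \<alpha> w k)) = t B - t A"
  using edge unfolding edge_def
proof
  assume "\<exists>(a, b)\<in>T. u = ratio a b \<and> A = word_root \<alpha> w b \<and> B = word_root \<alpha> w a"
  then obtain a b where "u = ratio a b" "A = word_root \<alpha> w b" "B = word_root \<alpha> w a"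
    by blast
  moreover from this edge_diff \<beta> have "a \<noteq> b"
    by auto
  ultimately show ?thesis
    by (simp add: linear_form_ratio)
qed (use assms in simp)

text \<open>Roots are nonzero, so edges from 0 come only from the single variable; roots along w are
  distinct, so any other edge determines its two positions.\<close>

lemma edge_unique:
  assumes "edge w p T u' A B"
  shows "u' = u"
proof (cases "A = 0")
  case True
  have "word_root \<alpha> w b \<noteq> 0" if "(a, b) \<in> T" for a b
    using root_pairs_memD(4)[OF pairs that] word_root_positive[OF w] root_nonzero
    unfolding positive_def by blast
  then show ?thesis
    using True edge assms unfolding edge_def by auto
next
  case False
  then obtain a b a' b' where "(a, b) \<in> T" "u = ratio a b" "A = word_root \<alpha> w b" "B = word_root \<alpha> w a"
    and "(a', b') \<in> T" "u' = ratio a' b'" "A = word_root \<alpha> w b'" "B = word_root \<alpha> w a'"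
    using edge assms unfolding edge_def by auto
  then show ?thesis
    using root_pairs_memD(2,4)[OF pairs] word_root_eq_iff[OF w] by metis
qed

end

text \<open>
  The inequalities form the edges of a graph on the roots and 0 along which the height increases by
  one.  The test function is the indicator of an upper set that is left only along the given edge.
\<close>

lemma separating_function:
  assumes AB: "height B = height A + 1" "A = 0 \<or> positive A" "positive B"
  obtains t :: "'a \<Rightarrow> real" where "t 0 = 0" "t B - t A < 0"
    "\<And>A' B'. height B' = height A' + 1 \<Longrightarrow> A' = 0 \<or> positive A' \<Longrightarrow> positive B' \<Longrightarrow>
      (A', B') \<noteq> (A, B) \<Longrightarrow> 0 \<le> t B' - t A'"
proof -
  have h0: "height 0 = 0"
    by (rule linear_0[OF linear_height])
  have B: "height B \<ge> 1" "B \<noteq> 0"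
    using height_positive[OF AB(3)] h0 by auto
  show ?thesis
  proof (cases "A = 0")
    case True
    \<comment> \<open>The indicator of the complement of B, lowered by 1 so that it vanishes at 0.
      An edge into B starts at height 0, hence at 0, so it is the given one.\<close>
    let ?t = "\<lambda>x. if x = B then -1 else 0 :: real"
    show ?thesis
    proof (rule that[of ?t])
      fix A' B'
      assume A'B': "height B' = height A' + 1" "A' = 0 \<or> positive A'" "(A', B') \<noteq> (A, B)"
      have "B' \<noteq> B"
      proof
        assume "B' = B"
        then have "height A' = 0"
          using A'B'(1) AB(1) True h0 by simp
        then show False
          using A'B' height_positive[of A'] True \<open>B' = B\<close> by auto
      qed
      then show "0 \<le> ?t B' - ?t A'"
        by simp
    qed (use B True in auto)
  next
    case False
    \<comment> \<open>All vectors of height at least that of B, with B removed and A added. Every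
      edge from A other than the given one ends in this set, and 0 lies outside.\<close>
    let ?t = "\<lambda>x. if x = A \<or> height B \<le> height x \<and> x \<noteq> B then 1 else 0 :: real"
    show ?thesis
    proof (rule that[of ?t])
      show "?t B - ?t A < 0"
        using AB(1) by auto
    qed (use B AB(1) False h0 in auto)
  qed
qed

end

theorem theorem3:
  fixes \<Phi> :: "'a::euclidean_space set"
    and n :: nat
    and \<alpha> :: "nat \<Rightarrow> 'a"
    and \<sigma> :: "nat list \<Rightarrow> nat \<Rightarrow> ratfun"
    and w :: "nat list"
  assumes "irreducible_root_system \<Phi>"
    and "simple_roots \<Phi> n \<alpha>"
    and "simply_laced n \<alpha>"
    and "sigma_family n \<alpha> \<sigma>"
    and "w \<in> reduced_words n \<alpha>"
    and "simply_braided n \<alpha> w"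
  shows "(\<forall>i\<in>{1..n}. multiplicity_free (\<sigma> w i)) \<and>
    \<not> redundant (SIGMA i:{1..n}. monomials (\<sigma> w i)) (\<lambda>(i, u). linear_form u)"
proof -
  interpret simply_laced_root_system \<Phi> n \<alpha>
    using assms(1-3) by unfold_locales (auto simp: irreducible_root_system_def)
  have "\<forall>i\<in>{1..n}. \<exists>p T. root_pairs \<alpha> w (\<alpha> (star n \<alpha> i)) p T \<and> \<sigma> w i = var_sum p T"
    using sigma_simply_braided[OF assms(4) _ _ _ assms(5)] assms(6)
    unfolding simply_braided_def simply_braided_for_def by blast
  then obtain p T where pairs: "\<And>i. i \<in> {1..n} \<Longrightarrow> root_pairs \<alpha> w (\<alpha> (star n \<alpha> i)) (p i) (T i)"
    and \<sigma>: "\<And>i. i \<in> {1..n} \<Longrightarrow> \<sigma> w i = var_sum (p i) (T i)"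
    by metis
  note w = reduced_if_in_reduced_words[OF assms(5)]
  let ?M = "SIGMA i:{1..n}. monomials (\<sigma> w i)"
  have ex_edge: "\<exists>A B. edge w (p i) (T i) u A B" if "(i, u) \<in> ?M" for i u
    using that \<sigma> edge_exists by auto
  have nz: "\<alpha> (star n \<alpha> i) \<noteq> 0" if "i \<in> {1..n}" for i
    using longest_element_star(1)[OF that] by (rule simple_root_nonzero)
  have edge: "B = A + \<alpha> (star n \<alpha> i)" "height B = height A + 1" "A = 0 \<or> positive A" "positive B"
    "\<And>t. t 0 = 0 \<Longrightarrow> linear_form u (\<lambda>k. t (word_root \<alpha> w k)) = t B - t A"
    if "i \<in> {1..n}" "edge w (p i) (T i) u A B" for i u A B
  proof -
    show diff: "B = A + \<alpha> (star n \<alpha> i)"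
      using edge_diff[OF w pairs nz] that by blast
    show "height B = height A + 1"
      using longest_element_star(1)[OF that(1)] by (simp add: diff linear_add[OF linear_height])
    show "A = 0 \<or> positive A" "positive B"
      using edge_positive[OF w pairs nz] that by blast+
    show "\<And>t. t 0 = 0 \<Longrightarrow> linear_form u (\<lambda>k. t (word_root \<alpha> w k)) = t B - t A"
      using linear_form_edge[OF w pairs nz] that by blast
  qed
  have "\<not> redundant ?M (\<lambda>(i, u). linear_form u)"
  proof (rule not_redundantI)
    fix m assume m: "m \<in> ?M"
    then obtain i u where iu: "m = (i, u)" "i \<in> {1..n}"
      by auto
    obtain A B where AB: "edge w (p i) (T i) u A B"
      using m iu ex_edge by blast
    obtain t :: "'a \<Rightarrow> real" where t: "t 0 = 0" "t B - t A < 0"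
      "\<And>A' B'. height B' = height A' + 1 \<Longrightarrow> A' = 0 \<or> positive A' \<Longrightarrow> positive B' \<Longrightarrow>
        (A', B') \<noteq> (A, B) \<Longrightarrow> 0 \<le> t B' - t A'"
      using separating_function[OF edge(2-4)[OF iu(2) AB]] by blast
    let ?t = "\<lambda>k. t (word_root \<alpha> w k)"
    have "0 \<le> linear_form u' ?t" if m': "(i', u') \<in> ?M - {m}" for i' u'
    proof -
      have i': "i' \<in> {1..n}"
        using m' by auto
      obtain A' B' where A'B': "edge w (p i') (T i') u' A' B'"
        using m' ex_edge by blast
      \<comment> \<open>An edge determines its index and monomial: B - A is the simple root of index
        \<open>star n \<alpha> i\<close>, \<open>star\<close> is injective, and for fixed i
        \<open>edge_unique\<close> applies.\<close>
      have "(A', B') \<noteq> (A, B)"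
      proof
        assume eq: "(A', B') = (A, B)"
        then have "\<alpha> (star n \<alpha> i') = \<alpha> (star n \<alpha> i)"
          using edge(1)[OF iu(2) AB] edge(1)[OF i' A'B'] by (metis Pair_inject add_left_cancel)
        then have "i' = i"
          using simple_root_inj longest_element_star(1) star_inj iu(2) i' by metis
        then have "u' = u"
          using edge_unique[OF w pairs[OF iu(2)] nz[OF iu(2)] AB] A'B' eq by simp
        then show False
          using m' iu(1) \<open>i' = i\<close> by simp
      qed
      then show ?thesis
        using t(3) edge[OF i' A'B'] t(1) by metis
    qed
    then have "0 \<le> (\<lambda>(i, u). linear_form u) m' ?t" if "m' \<in> ?M - {m}" for m'
      using that by (cases m') (simp only: prod.case)
    moreover have "(\<lambda>(i, u). linear_form u) m ?t < 0"
      using edge(5)[where t = t, OF iu(2) AB t(1)] t(2) iu(1) by simp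
    ultimately show "\<exists>t. (\<lambda>(i, u). linear_form u) m t < 0 \<and>
        (\<forall>m'\<in>?M - {m}. 0 \<le> (\<lambda>(i, u). linear_form u) m' t)"
      by blast
  qed
  then show ?thesis
    using \<sigma> multiplicity_free_var_sum by simp
qed

end
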